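(* For every integer $n\ge1$, the variance of the number $X_n$ of swaps of Quicksort for a list of length $n$ under Variant II is $$\frac16 n(11n+17)-\frac13(n+1)H_1(n)-(n+1)^2H_2(n).$$
   Context: $H_k(n)=\sum_{i=1}^n \frac1{i^k}$. Variant II of Quicksort, applied to a uniformly random ordering of $n$ distinct elements: the position $i\in\{1,\dots,n\}$ of the pivot is chosen uniformly at random; each element before the pivot that is larger than the pivot is moved to the end of the list (one swap), and each element after the pivot that is smaller than the pivot is inserted before the pivot (one swap); then the procedure is applied recursively to the two sublists. $X_n$ is the total number of swaps. Formally, let $Q(n,k,i,t)$ be the probability generating function of the number of entries that are either before position $i$ and larger than $k$, or after position $i$ and smaller than $k$, in a uniformly random permutation of $\{1,\dots,n\}$ conditioned on its $i$-th entry being $k$. The probability generating function $P_n(t)=\sum_{m\ge0}P(X_n=m)t^m$ is determined by $P_0(t)=P_1(t)=1$ and $P_n(t)=\frac1{n^2}\sum_{k=1}^n\sum_{i=1}^n P_{k-1}(t)P_{n-k}(t)Q(n,k,i,t)$ for $n\ge2$. *)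

theory Defs
  imports "HOL-Probability.Probability" "HOL-Combinatorics.Multiset_Permutations"
begin

definition H :: "nat \<Rightarrow> nat \<Rightarrow> real" where
  "H k n = (\<Sum>i = 1..n. 1 / real i ^ k)"

text \<open>
  One partitioning step with the pivot in the (0-based) position \<open>i\<close>. Each larger element in
  front of the pivot is moved to the end of the list and each smaller element behind it is inserted
  before the pivot; \<open>smaller_part\<close> and \<open>larger_part\<close> are the two sublists that result, in the
  order in which they then stand. \<open>partition_swaps\<close> charges one swap for each moved element.
\<close>

definition partition_swaps :: "nat list \<Rightarrow> nat \<Rightarrow> nat" where
  "partition_swaps xs i =
     length (filter (\<lambda>x. x > xs ! i) (take i xs)) +
     length (filter (\<lambda>x. x < xs ! i) (drop (Suc i) xs))"

definition smaller_part :: "nat list \<Rightarrow> nat \<Rightarrow> nat list" where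
  "smaller_part xs i =
     filter (\<lambda>x. x < xs ! i) (take i xs) @ filter (\<lambda>x. x < xs ! i) (drop (Suc i) xs)"

definition larger_part :: "nat list \<Rightarrow> nat \<Rightarrow> nat list" where
  "larger_part xs i =
     filter (\<lambda>x. x > xs ! i) (drop (Suc i) xs) @ filter (\<lambda>x. x > xs ! i) (take i xs)"

lemma length_filter_take_drop_less:
  assumes "i < length xs"
  shows "length (filter P (take i xs)) + length (filter Q (drop (Suc i) xs)) < length xs"
proof -
  have "length (filter P (take i xs)) \<le> i"
    using length_filter_le[of P "take i xs"] assms by simp
  moreover have "length (filter Q (drop (Suc i) xs)) \<le> length xs - Suc i"
    using length_filter_le[of Q "drop (Suc i) xs"] by simp
  ultimately show ?thesis
    using assms by linarith
qed

lemma length_smaller_part_less: "i < length xs \<Longrightarrow> length (smaller_part xs i) < length xs"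
  by (simp add: smaller_part_def length_filter_take_drop_less)

lemma length_larger_part_less: "i < length xs \<Longrightarrow> length (larger_part xs i) < length xs"
  by (simp add: larger_part_def add.commute length_filter_take_drop_less)

text \<open>
  The distribution of the number of swaps on the given list \<open>xs\<close>, over the random choices of the
  pivot positions (uniform, and independent in all recursive calls).
\<close>

function quicksort_swaps :: "nat list \<Rightarrow> nat pmf" where
  "quicksort_swaps xs =
     (if length xs \<le> 1 then return_pmf 0
      else do {
        i \<leftarrow> pmf_of_set {..<length xs};
        a \<leftarrow> quicksort_swaps (smaller_part xs i);
        b \<leftarrow> quicksort_swaps (larger_part xs i);
        return_pmf (partition_swaps xs i + a + b)
      })"
  by auto
termination
proof (relation "Wellfounded.measure length", goal_cases)
  case 1
  show ?case by simp
next
  case (2 xs i)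
  then have "{..<length xs} \<noteq> {}" by (cases xs) (auto simp: lessThan_empty_iff)
  with 2 have "i < length xs" by (simp add: set_pmf_of_set)
  then show ?case by (simp add: length_smaller_part_less)
next
  case (3 xs i a)
  then have "{..<length xs} \<noteq> {}" by (cases xs) (auto simp: lessThan_empty_iff)
  with 3 have "i < length xs" by (simp add: set_pmf_of_set)
  then show ?case by (simp add: length_larger_part_less)
qed

declare quicksort_swaps.simps [simp del]

text \<open>
  The distribution of $X_n$: the input is a uniformly random ordering of $\{1,\dots,n\}$. Given that
  the pivot at position \<open>i\<close> is \<open>k\<close>, the two parts are independent uniformly random orderings of their
  elements, also independent of \<open>partition_swaps\<close>; this gives the recurrence
  $P_n = \frac{1}{n^2} \sum_{k,i} P_{k-1} P_{n-k} Q(n,k,i,\cdot)$ for the probability generating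
  functions, where $Q(n,k,i,\cdot)$ is that of \<open>partition_swaps\<close>.
\<close>

definition swaps :: "nat \<Rightarrow> nat pmf" where
  "swaps n = bind_pmf (pmf_of_set (permutations_of_set {1..n})) quicksort_swaps"

end

theory Submission
  imports Defs
begin

text \<open>
  Let \<open>c\<close> be the number of swaps of the first partitioning step, let \<open>i\<close> be the pivot position,
  counted from \<open>0\<close>, and let \<open>b\<close> be the number of elements that are smaller than the pivot. Write
  \<open>N = n - 1\<close>. Three observations carry the proof.

  A uniformly random ordering together with a position \<open>i\<close> can be encoded without loss by the pivot,
  the set \<open>S\<close> of positions of the smaller elements, and the two sublists that the partition produces
  (\<open>bij_betw_partition\<close>). Hence, given the pivot, the set \<open>S\<close> is a uniformly random \<open>b\<close>-subset of the
  \<open>N\<close> other positions, and both sublists are uniformly random orderings, all three independent. As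
  \<open>c\<close> depends only on \<open>i\<close> and \<open>S\<close>, this is the recurrence \<open>X\<^sub>n = c + X\<^sub>b + X'\<^sub>N\<^sub>-\<^sub>b\<close> with independent
  summands once \<open>i\<close> and \<open>b\<close> are given (\<open>swaps_recurrence_by_rank\<close>).

  If \<open>j\<close> of the elements of \<open>S\<close> lie in front of \<open>i\<close>, then \<open>c = (i - j) + (b - j)\<close>, and \<open>j\<close> is
  hypergeometric. Its mean is \<open>i * b / N\<close>, so averaging \<open>c\<close> over \<open>i\<close> gives \<open>N / 2\<close> for every \<open>b\<close>
  (\<open>sum_partition_mean\<close>): the cost of the step is uncorrelated with the cost of the recursive calls.
  Only the average \<open>(5 * N\<^sup>2 + 4 * N) / 18\<close> of \<open>c\<^sup>2\<close> enters besides
  (\<open>sum_partition_second_moment\<close>). With \<open>\<mu>\<close> for the mean and \<open>s\<close> for the second moment,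
  the recurrences are
    \<open>n * \<mu> n = n * N / 2 + 2 * (\<Sum>m<n. \<mu> m)\<close> and
    \<open>n * s n = n * (5 * N\<^sup>2 + 4 * N) / 18 + 2 * N * (\<Sum>m<n. \<mu> m) + 2 * (\<Sum>m<n. s m) + 2 * (\<mu> * \<mu>) N\<close>,
  where \<open>\<mu> * \<mu>\<close> in the last term is a convolution.

  The first has the solution \<open>\<mu> n = (n + 1) * H\<^sub>1 n - 2 * n\<close>. Its convolution with itself gets a closed form
  by taking differences: the differences of \<open>\<mu>\<close> are \<open>H\<^sub>1 (n + 1) - 1\<close>, whose differences in turn are
  \<open>1 / (n + 2)\<close>, and taking a difference in either factor of a convolution replaces that factor by
  its differences. After four differences only a convolution of reciprocals is left, and partial
  fractions evaluate it (\<open>convolution_recip_recip\<close>); summing up again gives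
  \<open>convolution_mean_mean\<close>. The second recurrence has only one solution, and inserting the claimed
  variance plus \<open>\<mu>\<^sup>2\<close> verifies that this is it.
\<close>

section \<open>A partition through the positions of the smaller elements\<close>

text \<open>
  A list is an interleaving of its elements with \<open>P\<close> and those without; the list of truth values of \<open>P\<close>
  says how to interleave.
\<close>

lemma list_eq_if_pattern_and_parts_eq:
  assumes "map P us = map P vs" "filter P us = filter P vs"
    "filter (\<lambda>x. \<not> P x) us = filter (\<lambda>x. \<not> P x) vs"
  shows "us = vs"
proof -
  have "length us = length vs"
    using assms(1) map_eq_imp_length_eq by blast
  then show ?thesis
    using assms by (induction us vs rule: list_induct2) (auto split: if_splits)
qed

lemma length_filter_eq_if_pattern_eq:
  assumes "map P us = map P vs"
  shows "length (filter P us) = length (filter P vs)"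
proof -
  have "length (filter P zs) = length (filter id (map P zs))" for zs
    by (simp add: filter_map)
  from this[of us] this[of vs] show ?thesis by (simp only: assms)
qed

text \<open>
  The set \<open>S\<close> of the overview; it carries the same information as the pattern of smaller and larger
  elements.
\<close>

definition smaller_positions :: "nat list \<Rightarrow> nat \<Rightarrow> nat set" where
  "smaller_positions xs i = {j. j < length xs \<and> xs ! j < xs ! i}"

text \<open>
  In a list without repetitions, the larger elements in front of the pivot sit at the positions below
  \<open>i\<close> outside \<open>S\<close>, and the smaller elements behind it at the elements of \<open>S\<close> above \<open>i\<close>.
\<close>

definition swaps_of_positions :: "nat \<Rightarrow> nat set \<Rightarrow> nat" where
  "swaps_of_positions i S = card ({..<i} - S) + card (S - {..<i})"

lemma partition_swaps_eq:
  assumes "distinct xs" "i < length xs"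
  shows "partition_swaps xs i = swaps_of_positions i (smaller_positions xs i)"
proof -
  have "length (filter (\<lambda>x. x > xs ! i) (take i xs)) = card ({..<i} - smaller_positions xs i)"
  proof -
    have "{j. j < length (take i xs) \<and> take i xs ! j > xs ! i} = {..<i} - smaller_positions xs i"
      using assms by (auto simp: smaller_positions_def not_less order.order_iff_strict nth_eq_iff_index_eq)
    then show ?thesis by (simp only: length_filter_conv_card)
  qed
  moreover have "length (filter (\<lambda>x. x < xs ! i) (drop (Suc i) xs)) = card (smaller_positions xs i - {..<i})"
  proof -
    have "bij_betw (\<lambda>j. Suc i + j) {j. j < length (drop (Suc i) xs) \<and> drop (Suc i) xs ! j < xs ! i}
            (smaller_positions xs i - {..<i})"
      unfolding bij_betw_def
    proof
      show "(\<lambda>j. Suc i + j) ` {j. j < length (drop (Suc i) xs) \<and> drop (Suc i) xs ! j < xs ! i}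
              = smaller_positions xs i - {..<i}" (is "_ ` ?L = ?R")
      proof
        show "(\<lambda>j. Suc i + j) ` ?L \<subseteq> ?R"
          using assms by (auto simp: smaller_positions_def)
        show "?R \<subseteq> (\<lambda>j. Suc i + j) ` ?L"
        proof
          fix j assume j: "j \<in> ?R"
          then have "j \<noteq> i" by (auto simp: smaller_positions_def)
          with j have "Suc i \<le> j" by auto
          with j have "j = Suc i + (j - Suc i)" "j - Suc i \<in> ?L"
            by (auto simp: smaller_positions_def)
          then show "j \<in> (\<lambda>j. Suc i + j) ` ?L" by blast
        qed
      qed
    qed auto
    then show ?thesis by (simp only: length_filter_conv_card bij_betw_same_card)
  qed
  ultimately show ?thesis
    by (simp add: partition_swaps_def swaps_of_positions_def)
qed

lemma map_less_eq_if_smaller_positions_eq: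
  assumes "smaller_positions xs i = smaller_positions ys i" "length xs = length ys"
    "xs ! i = k" "ys ! i = k"
  shows "map (\<lambda>x. x < k) xs = map (\<lambda>x. x < k) ys"
proof (rule nth_equalityI)
  fix j assume "j < length (map (\<lambda>x. x < k) xs)"
  then show "map (\<lambda>x. x < k) xs ! j = map (\<lambda>x. x < k) ys ! j"
    using assms by (force simp: smaller_positions_def set_eq_iff)
qed (use assms in simp)

text \<open>
  The pattern of smaller and larger elements tells how many elements of each sublist come from in
  front of the pivot. So both sublists can be cut at the right place, although \<open>larger_part\<close>
  exchanges its two pieces, and the two sides of the pivot are interleaved again separately.
\<close>

lemma partition_inj:
  assumes "distinct xs" "distinct ys" "length xs = length ys" "i < length xs"
    and pivot: "xs ! i = ys ! i"
    and pos: "smaller_positions xs i = smaller_positions ys i"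
    and small: "smaller_part xs i = smaller_part ys i"
    and large: "larger_part xs i = larger_part ys i"
  shows "xs = ys"
proof -
  define k P where "k = xs ! i" and "P = (\<lambda>x. x < k)"
  have pat: "map P xs = map P ys"
    unfolding P_def using assms by (intro map_less_eq_if_smaller_positions_eq) (auto simp: k_def)
  define a b c d where "a = take i xs" "b = drop (Suc i) xs" "c = take i ys" "d = drop (Suc i) ys"
  have xs: "xs = a @ k # b"
    unfolding a_b_c_d_def k_def using assms by (intro id_take_nth_drop) simp
  have ys: "ys = c @ k # d"
    unfolding a_b_c_d_def k_def pivot using assms by (intro id_take_nth_drop) simp
  have pat': "map P a = map P c" "map P b = map P d"
    using arg_cong[OF pat, of "take i"] arg_cong[OF pat, of "drop (Suc i)"]
    by (simp_all only: a_b_c_d_def take_map drop_map)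
  have len: "length (filter P a) = length (filter P c)" "length (filter P b) = length (filter P d)"
    using pat'[THEN length_filter_eq_if_pattern_eq] by simp_all
  have "length b = length d"
    using pat'(2) by (rule map_eq_imp_length_eq)
  have neg: "filter (\<lambda>x. k < x) zs = filter (\<lambda>x. \<not> P x) zs" if "k \<notin> set zs" for zs
    using that by (intro filter_cong) (auto simp: P_def not_less order.order_iff_strict)
  have nin: "k \<notin> set a" "k \<notin> set b" "k \<notin> set c" "k \<notin> set d"
    using assms(1,2) by (auto simp: xs ys)
  \<comment> \<open>The larger elements behind the pivot come first in \<open>larger_part\<close>, so their number is the cut.\<close>
  have len': "length (filter (\<lambda>x. \<not> P x) b) = length (filter (\<lambda>x. \<not> P x) d)"
    using len \<open>length b = length d\<close> sum_length_filter_compl[of P b] sum_length_filter_compl[of P d] by linarith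
  have "filter P a @ filter P b = filter P c @ filter P d"
    using small pivot unfolding smaller_part_def P_def k_def a_b_c_d_def by simp
  then have P_parts: "filter P a = filter P c" "filter P b = filter P d"
    using len by simp_all
  have "larger_part xs i = filter (\<lambda>x. \<not> P x) b @ filter (\<lambda>x. \<not> P x) a"
    unfolding neg[OF nin(1), symmetric] neg[OF nin(2), symmetric]
    unfolding larger_part_def a_b_c_d_def k_def by (rule refl)
  moreover have "larger_part ys i = filter (\<lambda>x. \<not> P x) d @ filter (\<lambda>x. \<not> P x) c"
    unfolding neg[OF nin(3), symmetric] neg[OF nin(4), symmetric]
    unfolding larger_part_def a_b_c_d_def k_def pivot by (rule refl)
  ultimately have "filter (\<lambda>x. \<not> P x) b @ filter (\<lambda>x. \<not> P x) a =
      filter (\<lambda>x. \<not> P x) d @ filter (\<lambda>x. \<not> P x) c"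
    using large by (elim trans[OF trans[OF sym]])
  then have not_P_parts: "filter (\<lambda>x. \<not> P x) b = filter (\<lambda>x. \<not> P x) d \<and>
      filter (\<lambda>x. \<not> P x) a = filter (\<lambda>x. \<not> P x) c"
    by (rule iffD1[OF append_eq_append_conv[OF disjI1[OF len']]])
  have "a = c"
    by (rule list_eq_if_pattern_and_parts_eq[OF pat'(1) P_parts(1) conjunct2[OF not_P_parts]])
  moreover have "b = d"
    by (rule list_eq_if_pattern_and_parts_eq[OF pat'(2) P_parts(2) conjunct1[OF not_P_parts]])
  ultimately show ?thesis by (simp only: xs ys)
qed

section \<open>The partition of a uniformly random ordering\<close>

text \<open>
  The possible sets of positions of the smaller elements, if there are \<open>b\<close> of them and the pivot is at
  position \<open>i\<close> of \<open>n\<close>.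
\<close>

definition smaller_position_sets :: "nat \<Rightarrow> nat \<Rightarrow> nat \<Rightarrow> nat set set" where
  "smaller_position_sets n i b = {S. S \<subseteq> {..<n} - {i} \<and> card S = b}"

lemma smaller_position_sets_nonempty:
  assumes "i < n" "b < n"
  shows "smaller_position_sets n i b \<noteq> {}"
proof -
  have "b \<le> card ({..<n} - {i})" using assms by simp
  then obtain S where "S \<subseteq> {..<n} - {i}" "card S = b"
    by (rule obtain_subset_with_card_n)
  then show ?thesis by (auto simp: smaller_position_sets_def)
qed

lemma finite_smaller_position_sets: "finite (smaller_position_sets n i b)"
  by (simp add: smaller_position_sets_def)

lemma length_permutation_of_set: "xs \<in> permutations_of_set A \<Longrightarrow> length xs = card A"
  by (metis permutations_of_setD distinct_card)

definition partition_outcomes :: "nat set \<Rightarrow> nat \<Rightarrow> nat \<Rightarrow> (nat set \<times> nat list \<times> nat list) set" where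
  "partition_outcomes A i k =
     smaller_position_sets (card A) i (card {x \<in> A. x < k}) \<times>
     permutations_of_set {x \<in> A. x < k} \<times> permutations_of_set {x \<in> A. k < x}"

lemma finite_partition_outcomes: "finite A \<Longrightarrow> finite (partition_outcomes A i k)"
  by (simp add: partition_outcomes_def finite_smaller_position_sets)

text \<open>
  With \<open>b\<close> smaller and \<open>c\<close> larger elements the number is \<open>((b + c) choose b) * fact b * fact c\<close>. It
  does not depend on \<open>k\<close>, which makes the pivot uniformly distributed.
\<close>

lemma card_partition_outcomes:
  assumes "finite A" "i < card A" "k \<in> A"
  shows "card (partition_outcomes A i k) = fact (card A - 1)"
proof -
  define b c where "b = card {x \<in> A. x < k}" "c = card {x \<in> A. k < x}"
  have "A = insert k ({x \<in> A. x < k} \<union> {x \<in> A. k < x})" using assms by auto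
  moreover have "card ({x \<in> A. x < k} \<union> {x \<in> A. k < x}) = b + c"
    unfolding b_c_def using assms by (intro card_Un_disjoint) auto
  then have "card (insert k ({x \<in> A. x < k} \<union> {x \<in> A. k < x})) = Suc (b + c)"
    using assms by (subst card_insert_disjoint) auto
  ultimately have n: "card A - 1 = b + c" by simp
  have "card ({..<card A} - {i}) = b + c"
    using assms n by simp
  then have "card {S. S \<subseteq> {..<card A} - {i} \<and> card S = b} = (b + c) choose b"
    by (subst n_subsets) auto
  then show ?thesis
    using assms n binomial_fact_lemma[of b "b + c"]
    by (simp add: partition_outcomes_def smaller_position_sets_def card_cartesian_product flip: b_c_def)
       (metis mult.commute mult.assoc)
qed

lemma partition_in_outcomes:
  assumes xs: "xs \<in> permutations_of_set A" and "i < card A"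
  shows "(smaller_positions xs i, smaller_part xs i, larger_part xs i) \<in> partition_outcomes A i (xs ! i)"
proof -
  have A: "set xs = A" "distinct xs" "length xs = card A"
    using xs by (simp_all add: permutations_of_setD length_permutation_of_set)
  define k a b where "k = xs ! i" "a = take i xs" "b = drop (Suc i) xs"
  have dec: "xs = a @ k # b"
    unfolding k_a_b_def using assms A by (intro id_take_nth_drop) simp
  have "smaller_positions xs i \<subseteq> {..<card A} - {i}"
    using A by (auto simp: smaller_positions_def)
  moreover have "bij_betw ((!) xs) (smaller_positions xs i) {x \<in> A. x < k}"
    using A unfolding bij_betw_def
    by (auto simp: inj_on_def smaller_positions_def k_a_b_def nth_eq_iff_index_eq in_set_conv_nth image_iff)
  then have "card (smaller_positions xs i) = card {x \<in> A. x < k}"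
    by (rule bij_betw_same_card)
  moreover have "smaller_part xs i = filter (\<lambda>x. x < k) a @ filter (\<lambda>x. x < k) b"
    by (simp add: smaller_part_def k_a_b_def)
  then have "smaller_part xs i \<in> permutations_of_set {x \<in> A. x < k}"
    using A(1,2) by (intro permutations_of_setI) (auto simp: dec)
  moreover have "larger_part xs i = filter (\<lambda>x. k < x) b @ filter (\<lambda>x. k < x) a"
    by (simp add: larger_part_def k_a_b_def)
  then have "larger_part xs i \<in> permutations_of_set {x \<in> A. k < x}"
    using A(1,2) by (intro permutations_of_setI) (auto simp: dec)
  ultimately show ?thesis
    by (simp add: partition_outcomes_def smaller_position_sets_def k_a_b_def)
qed

text \<open>
  Injectivity is \<open>partition_inj\<close>; surjectivity follows by counting, since both sides have \<open>fact (card A)\<close>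
  elements.
\<close>

lemma bij_betw_partition:
  assumes "finite A" "i < card A"
  shows "bij_betw (\<lambda>xs. (xs ! i, smaller_positions xs i, smaller_part xs i, larger_part xs i))
           (permutations_of_set A) (SIGMA k:A. partition_outcomes A i k)"
    (is "bij_betw ?f ?X ?Y")
proof -
  have len: "length xs = card A" "distinct xs" "set xs = A" if "xs \<in> ?X" for xs
    using that by (simp_all add: permutations_of_setD length_permutation_of_set)
  have inj: "inj_on ?f ?X"
  proof (rule inj_onI)
    fix xs ys assume "xs \<in> ?X" "ys \<in> ?X" "?f xs = ?f ys"
    then show "xs = ys"
      using assms(2) len[of xs] len[of ys] by (intro partition_inj[of xs ys i]) simp_all
  qed
  have sub: "?f ` ?X \<subseteq> ?Y"
  proof
    fix y assume "y \<in> ?f ` ?X"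
    then obtain xs where xs: "xs \<in> ?X" "y = ?f xs" by blast
    then have "xs ! i \<in> A" using len[of xs] assms nth_mem[of i xs] by auto
    then show "y \<in> ?Y" using xs partition_in_outcomes[of xs A i] assms by auto
  qed
  have fin: "finite ?Y" using assms by (auto intro: finite_partition_outcomes)
  have "card ?Y = (\<Sum>k\<in>A. fact (card A - 1))"
    using assms by (subst card_SigmaI) (auto intro: finite_partition_outcomes simp: card_partition_outcomes)
  also have "\<dots> = fact (card A)"
    using assms fact_reduce[of "card A", where 'a = nat] by simp
  also have "\<dots> = card (?f ` ?X)"
    using assms inj by (simp add: card_image)
  finally have "?f ` ?X = ?Y"
    using fin sub by (intro card_subset_eq) simp_all
  with inj show ?thesis by (simp add: bij_betw_def)
qed

lemma pmf_of_set_times: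
  assumes "finite A" "A \<noteq> {}" "finite B" "B \<noteq> {}"
  shows "pmf_of_set (A \<times> B) = pair_pmf (pmf_of_set A) (pmf_of_set B)"
proof (rule pmf_eqI)
  fix x :: "'a \<times> 'b"
  show "pmf (pmf_of_set (A \<times> B)) x = pmf (pair_pmf (pmf_of_set A) (pmf_of_set B)) x"
    using assms by (cases x) (simp add: pmf_pair indicator_def card_cartesian_product)
qed

lemma pmf_of_set_Sigma:
  assumes "finite A" "A \<noteq> {}" "\<And>x. x \<in> A \<Longrightarrow> finite (B x)" "\<And>x. x \<in> A \<Longrightarrow> card (B x) = c" "c > 0"
  shows "pmf_of_set (SIGMA x:A. B x) = bind_pmf (pmf_of_set A) (\<lambda>x. map_pmf (Pair x) (pmf_of_set (B x)))"
proof -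
  have ne: "B x \<noteq> {}" if "x \<in> A" for x using assms(4)[OF that] assms(5) by auto
  have "(SIGMA x:A. B x) = (\<Union>x\<in>A. Pair x ` B x)" by auto
  also have "pmf_of_set \<dots> = bind_pmf (pmf_of_set A) (\<lambda>x. pmf_of_set (Pair x ` B x))"
    using assms ne
    by (intro pmf_of_set_UN[where n = c]) (auto simp: card_image inj_on_def disjoint_family_on_def)
  also have "\<dots> = bind_pmf (pmf_of_set A) (\<lambda>x. map_pmf (Pair x) (pmf_of_set (B x)))"
    using assms ne by (intro bind_pmf_cong refl) (auto simp: map_pmf_of_set_inj inj_on_def)
  finally show ?thesis .
qed

text \<open>
  This is the independence statement: given the pivot \<open>k\<close>, the positions and the two sublists are
  uniform on a product set.
\<close>

lemma partition_of_random_permutation: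
  assumes "finite A" "i < card A"
  shows "map_pmf (\<lambda>xs. (xs ! i, smaller_positions xs i, smaller_part xs i, larger_part xs i))
           (pmf_of_set (permutations_of_set A)) =
         bind_pmf (pmf_of_set A) (\<lambda>k. map_pmf (Pair k) (pmf_of_set (partition_outcomes A i k)))"
proof -
  have "A \<noteq> {}" using assms by auto
  have "map_pmf (\<lambda>xs. (xs ! i, smaller_positions xs i, smaller_part xs i, larger_part xs i))
          (pmf_of_set (permutations_of_set A)) = pmf_of_set (SIGMA k:A. partition_outcomes A i k)"
    using assms by (intro map_pmf_of_set_bij_betw bij_betw_partition) auto
  also have "\<dots> = bind_pmf (pmf_of_set A) (\<lambda>k. map_pmf (Pair k) (pmf_of_set (partition_outcomes A i k)))"
    using assms \<open>A \<noteq> {}\<close>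
    by (intro pmf_of_set_Sigma[where c = "fact (card A - 1)"])
       (auto simp: finite_partition_outcomes card_partition_outcomes)
  finally show ?thesis .
qed

section \<open>The recurrence for the distribution of the number of swaps\<close>

lemma quicksort_swaps_trivial: "length xs \<le> 1 \<Longrightarrow> quicksort_swaps xs = return_pmf 0"
  by (subst quicksort_swaps.simps) (rule if_P)

lemma quicksort_swaps_step:
  "length xs \<ge> 2 \<Longrightarrow> quicksort_swaps xs = do {
      i \<leftarrow> pmf_of_set {..<length xs};
      a \<leftarrow> quicksort_swaps (smaller_part xs i);
      b \<leftarrow> quicksort_swaps (larger_part xs i);
      return_pmf (partition_swaps xs i + a + b)}"
  by (subst quicksort_swaps.simps) (rule if_not_P, simp)

text \<open>
  The procedure only compares elements. Shifts are enough to identify the recursive calls, because both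
  sublists of an ordering of an interval are orderings of intervals.
\<close>

lemma quicksort_swaps_shift: "quicksort_swaps (map ((+) d) xs) = quicksort_swaps xs"
proof (induction "length xs" arbitrary: xs rule: less_induct)
  case less
  show ?case
  proof (cases "length xs \<le> 1")
    case True
    then show ?thesis by (simp add: quicksort_swaps_trivial)
  next
    case False
    have parts: "partition_swaps (map ((+) d) xs) i = partition_swaps xs i"
        "smaller_part (map ((+) d) xs) i = map ((+) d) (smaller_part xs i)"
        "larger_part (map ((+) d) xs) i = map ((+) d) (larger_part xs i)" if "i < length xs" for i
      using that by (simp_all add: partition_swaps_def smaller_part_def larger_part_def
          take_map drop_map filter_map o_def)
    have pos: "set_pmf (pmf_of_set {..<length xs}) = {..<length xs}"
      using False by (intro set_pmf_of_set) (auto simp: lessThan_empty_iff)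
    have "quicksort_swaps (map ((+) d) xs) = do {
      i \<leftarrow> pmf_of_set {..<length xs};
      a \<leftarrow> quicksort_swaps (smaller_part (map ((+) d) xs) i);
      b \<leftarrow> quicksort_swaps (larger_part (map ((+) d) xs) i);
      return_pmf (partition_swaps (map ((+) d) xs) i + a + b)}"
      using False by (subst quicksort_swaps_step) simp_all
    also have "\<dots> = do {
      i \<leftarrow> pmf_of_set {..<length xs};
      a \<leftarrow> quicksort_swaps (smaller_part xs i);
      b \<leftarrow> quicksort_swaps (larger_part xs i);
      return_pmf (partition_swaps xs i + a + b)}"
      by (rule bind_pmf_cong[OF refl])
        (simp add: pos parts less length_smaller_part_less length_larger_part_less)
    also have "\<dots> = quicksort_swaps xs"
      using False by (simp add: quicksort_swaps_step[symmetric])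
    finally show ?thesis .
  qed
qed

lemma swaps_of_interval:
  "bind_pmf (pmf_of_set (permutations_of_set {Suc d..d + m})) quicksort_swaps = swaps m"
proof -
  have "permutations_of_set {Suc d..d + m} = map ((+) d) ` permutations_of_set {1..m}"
    by (subst permutations_of_set_image_inj[symmetric]) (auto simp: inj_on_def add.commute)
  also have "pmf_of_set \<dots> = map_pmf (map ((+) d)) (pmf_of_set (permutations_of_set {1..m}))"
    by (intro map_pmf_of_set_inj[symmetric]) (auto simp: inj_on_def)
  finally show ?thesis
    by (simp add: swaps_def bind_map_pmf quicksort_swaps_shift)
qed

lemma bind_swaps_of_interval:
  "bind_pmf (pmf_of_set (permutations_of_set {Suc d..d + m})) (\<lambda>xs. bind_pmf (quicksort_swaps xs) f) =
   bind_pmf (swaps m) f"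
  unfolding swaps_of_interval[of d m, symmetric] by (simp only: bind_assoc_pmf)

lemma swaps_0: "swaps 0 = return_pmf 0"
  by (simp add: swaps_def bind_return_pmf pmf_of_set_singleton quicksort_swaps_trivial)

lemma swaps_1: "swaps (Suc 0) = return_pmf 0"
  by (simp add: swaps_def bind_return_pmf pmf_of_set_singleton quicksort_swaps_trivial)

text \<open>
  The pivot position is drawn independently of the ordering, so it may be drawn first. Given it,
  \<open>partition_of_random_permutation\<close> makes the two sublists independent uniform orderings of intervals,
  and the recursive calls on them are distributed as \<open>swaps\<close>.
\<close>

lemma swaps_recurrence:
  assumes "n \<ge> 2"
  shows "swaps n = do {
      i \<leftarrow> pmf_of_set {..<n};
      k \<leftarrow> pmf_of_set {1..n};
      S \<leftarrow> pmf_of_set (smaller_position_sets n i (k - 1));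
      a \<leftarrow> swaps (k - 1);
      b \<leftarrow> swaps (n - k);
      return_pmf (swaps_of_positions i S + a + b)}"
proof -
  define F where "F = (\<lambda>i (k :: nat, S, s, l). do {
      a \<leftarrow> quicksort_swaps s; b \<leftarrow> quicksort_swaps l;
      return_pmf (swaps_of_positions i S + a + b)})"
  define R where "R = pmf_of_set (permutations_of_set {1..n})"
  have setR: "length xs = n" "distinct xs" if "xs \<in> set_pmf R" for xs
    using that by (auto simp: R_def dest: permutations_of_setD length_permutation_of_set)
  have "swaps n = bind_pmf R (\<lambda>xs. bind_pmf (pmf_of_set {..<n}) (\<lambda>i.
          F i (xs ! i, smaller_positions xs i, smaller_part xs i, larger_part xs i)))"
    unfolding swaps_def R_def[symmetric]
  proof (rule bind_pmf_cong[OF refl])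
    fix xs assume xs: "xs \<in> set_pmf R"
    have pos: "set_pmf (pmf_of_set {..<n}) = {..<n}"
      using assms by (intro set_pmf_of_set) (auto simp: lessThan_empty_iff)
    have "quicksort_swaps xs = bind_pmf (pmf_of_set {..<n}) (\<lambda>i.
        bind_pmf (quicksort_swaps (smaller_part xs i)) (\<lambda>a.
        bind_pmf (quicksort_swaps (larger_part xs i)) (\<lambda>b.
          return_pmf (partition_swaps xs i + a + b))))"
      using assms setR[OF xs] by (subst quicksort_swaps_step) simp_all
    also have "\<dots> = bind_pmf (pmf_of_set {..<n}) (\<lambda>i.
          F i (xs ! i, smaller_positions xs i, smaller_part xs i, larger_part xs i))"
      using setR[OF xs] pos by (intro bind_pmf_cong[OF refl]) (simp add: F_def partition_swaps_eq)
    finally show "quicksort_swaps xs = \<dots>" .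
  qed
  also have "\<dots> = bind_pmf (pmf_of_set {..<n}) (\<lambda>i. bind_pmf R (\<lambda>xs.
          F i (xs ! i, smaller_positions xs i, smaller_part xs i, larger_part xs i)))"
    by (rule bind_commute_pmf)
  also have "\<dots> = bind_pmf (pmf_of_set {..<n}) (\<lambda>i. bind_pmf (pmf_of_set {1..n}) (\<lambda>k.
         bind_pmf (pmf_of_set (smaller_position_sets n i (k - 1))) (\<lambda>S.
         bind_pmf (swaps (k - 1)) (\<lambda>a. bind_pmf (swaps (n - k)) (\<lambda>b.
           return_pmf (swaps_of_positions i S + a + b))))))"
  proof (rule bind_pmf_cong[OF refl])
    fix i assume "i \<in> set_pmf (pmf_of_set {..<n})"
    moreover have "{..<n} \<noteq> {}" using assms by (auto simp: lessThan_empty_iff)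
    ultimately have i: "i < n" by simp
    have "bind_pmf R (\<lambda>xs. F i (xs ! i, smaller_positions xs i, smaller_part xs i, larger_part xs i))
        = bind_pmf (map_pmf (\<lambda>xs. (xs ! i, smaller_positions xs i, smaller_part xs i, larger_part xs i)) R) (F i)"
      by (simp add: bind_map_pmf)
    also have "\<dots> = bind_pmf (pmf_of_set {1..n}) (\<lambda>k.
                       bind_pmf (pmf_of_set (partition_outcomes {1..n} i k)) (\<lambda>y. F i (k, y)))"
      unfolding R_def using i
      by (subst partition_of_random_permutation) (auto simp: bind_assoc_pmf bind_map_pmf)
    also have "\<dots> = bind_pmf (pmf_of_set {1..n}) (\<lambda>k.
         bind_pmf (pmf_of_set (smaller_position_sets n i (k - 1))) (\<lambda>S.
         bind_pmf (swaps (k - 1)) (\<lambda>a. bind_pmf (swaps (n - k)) (\<lambda>b.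
           return_pmf (swaps_of_positions i S + a + b)))))"
    proof (rule bind_pmf_cong[OF refl])
      fix k assume "k \<in> set_pmf (pmf_of_set {1..n})"
      then have k: "1 \<le> k" "k \<le> n" using assms by auto
      \<comment> \<open>The intervals are written with their offset, \<open>0\<close> or \<open>k\<close>, in the form of \<open>swaps_of_interval\<close>.\<close>
      have eqs: "{x \<in> {1..n}. x < k} = {Suc 0..0 + (k - 1)}" "{x \<in> {1..n}. k < x} = {Suc k..k + (n - k)}"
        using k by auto
      have sets: "partition_outcomes {1..n} i k = smaller_position_sets n i (k - 1) \<times>
              permutations_of_set {Suc 0..0 + (k - 1)} \<times> permutations_of_set {Suc k..k + (n - k)}"
        unfolding partition_outcomes_def eqs by simp
      have ne: "smaller_position_sets n i (k - 1) \<noteq> {}"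
        using i k by (intro smaller_position_sets_nonempty) auto
      have "bind_pmf (pmf_of_set (partition_outcomes {1..n} i k)) (\<lambda>y. F i (k, y)) =
         bind_pmf (pmf_of_set (smaller_position_sets n i (k - 1))) (\<lambda>S.
         bind_pmf (pmf_of_set (permutations_of_set {Suc 0..0 + (k - 1)})) (\<lambda>s.
         bind_pmf (pmf_of_set (permutations_of_set {Suc k..k + (n - k)})) (\<lambda>l.
         bind_pmf (quicksort_swaps s) (\<lambda>a. bind_pmf (quicksort_swaps l) (\<lambda>b.
           return_pmf (swaps_of_positions i S + a + b))))))"
        unfolding sets using ne
        by (simp add: pmf_of_set_times finite_smaller_position_sets pair_pmf_def bind_assoc_pmf bind_return_pmf F_def
            del: add_0_left)
      also have "\<dots> = bind_pmf (pmf_of_set (smaller_position_sets n i (k - 1))) (\<lambda>S.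
         bind_pmf (pmf_of_set (permutations_of_set {Suc 0..0 + (k - 1)})) (\<lambda>s.
         bind_pmf (quicksort_swaps s) (\<lambda>a.
         bind_pmf (pmf_of_set (permutations_of_set {Suc k..k + (n - k)})) (\<lambda>l.
         bind_pmf (quicksort_swaps l) (\<lambda>b.
           return_pmf (swaps_of_positions i S + a + b))))))"
        \<comment> \<open>The first recursive call may be run before the second sublist is drawn.\<close>
        by (rule bind_pmf_cong[OF refl], rule bind_pmf_cong[OF refl]) (rule bind_commute_pmf)
      also have "\<dots> = bind_pmf (pmf_of_set (smaller_position_sets n i (k - 1))) (\<lambda>S.
         bind_pmf (swaps (k - 1)) (\<lambda>a. bind_pmf (swaps (n - k)) (\<lambda>b.
           return_pmf (swaps_of_positions i S + a + b))))"
        by (simp only: bind_swaps_of_interval)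
      finally show "bind_pmf (pmf_of_set (partition_outcomes {1..n} i k)) (\<lambda>y. F i (k, y)) = \<dots>" .
    qed
    finally show "bind_pmf R (\<lambda>xs. F i (xs ! i, smaller_positions xs i, smaller_part xs i, larger_part xs i)) = \<dots>" .
  qed
  finally show ?thesis .
qed

section \<open>Moments of the intersection of a random subset with a fixed set\<close>

text \<open>
  Removing \<open>T\<close> leaves an arbitrary subset of \<open>U - T\<close> with \<open>b - card T\<close> elements.
\<close>

lemma card_subsets_containing:
  assumes "finite U" "T \<subseteq> U" "card T \<le> b"
  shows "card {S. S \<subseteq> U \<and> card S = b \<and> T \<subseteq> S} = (card U - card T) choose (b - card T)"
proof -
  have fT: "finite T" using assms finite_subset by blast
  have "bij_betw (\<lambda>S. S - T) {S. S \<subseteq> U \<and> card S = b \<and> T \<subseteq> S} {S. S \<subseteq> U - T \<and> card S = b - card T}"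
  proof (rule bij_betw_byWitness[where f' = "\<lambda>S. S \<union> T"])
    show "(\<lambda>S. S \<union> T) ` {S. S \<subseteq> U - T \<and> card S = b - card T} \<subseteq> {S. S \<subseteq> U \<and> card S = b \<and> T \<subseteq> S}"
    proof (intro image_subsetI)
      fix S assume "S \<in> {S. S \<subseteq> U - T \<and> card S = b - card T}"
      then have S: "S \<subseteq> U - T" "card S = b - card T" by auto
      then have "finite S" using assms(1) by (auto intro: finite_subset)
      then have "card (S \<union> T) = card S + card T"
        using S fT by (intro card_Un_disjoint) auto
      then show "S \<union> T \<in> {S. S \<subseteq> U \<and> card S = b \<and> T \<subseteq> S}"
        using S assms by auto
    qed
  qed (use assms fT in \<open>auto simp: card_Diff_subset\<close>)
  then have "card {S. S \<subseteq> U \<and> card S = b \<and> T \<subseteq> S} = card {S. S \<subseteq> U - T \<and> card S = b - card T}"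
    by (rule bij_betw_same_card)
  also have "\<dots> = (card U - card T) choose (b - card T)"
    using assms fT by (simp add: n_subsets card_Diff_subset)
  finally show ?thesis .
qed

text \<open>
  This and the following lemma give, after division by the number of all \<open>b\<close>-subsets, the probabilities
  that a random \<open>b\<close>-subset contains one or two given elements.
\<close>

lemma card_subsets_containing_1:
  assumes "finite U" "p \<in> U"
  shows "real (card {S. S \<subseteq> U \<and> card S = b \<and> p \<in> S}) =
           real b / real (card U) * real (card U choose b)"
proof (cases b)
  case 0
  have "{S. S \<subseteq> U \<and> card S = b \<and> p \<in> S} = {}"
    unfolding 0 using finite_subset[OF _ assms(1)] by auto
  then have "card {S. S \<subseteq> U \<and> card S = b \<and> p \<in> S} = 0"
    by (simp only: card.empty)
  then show ?thesis using 0 by simp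
next
  case (Suc b')
  obtain N where N: "card U = Suc N" using assms by (cases "card U") auto
  have "card {S. S \<subseteq> U \<and> card S = b \<and> p \<in> S} = N choose b'"
    using card_subsets_containing[of U "{p}" b] assms Suc N by simp
  moreover have "real (Suc N) * real (N choose b') = real (Suc N choose Suc b') * real (Suc b')"
    using Suc_times_binomial_eq[of N b'] by (simp only: of_nat_mult[symmetric])
  ultimately show ?thesis using N Suc by (simp add: field_simps)
qed

lemma card_subsets_containing_2:
  assumes "finite U" "p \<in> U" "q \<in> U" "p \<noteq> q"
  shows "real (card {S. S \<subseteq> U \<and> card S = b \<and> p \<in> S \<and> q \<in> S}) =
           real b * (real b - 1) / (real (card U) * (real (card U) - 1)) * real (card U choose b)"
proof (cases "b \<ge> 2")
  case False
  have empty: "{S. S \<subseteq> U \<and> card S = b \<and> p \<in> S \<and> q \<in> S} = {}"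
  proof -
    have "2 \<le> card S" if "S \<subseteq> U" "p \<in> S" "q \<in> S" for S
      using card_mono[of S "{p, q}"] that assms finite_subset[OF _ assms(1)] by auto
    then have "2 \<le> b" if "S \<subseteq> U" "card S = b" "p \<in> S" "q \<in> S" for S
      using that by blast
    then show ?thesis using False by blast
  qed
  have "b = 0 \<or> b = 1" using False by auto
  then show ?thesis unfolding empty by auto
next
  case True
  then obtain b' where b: "b = Suc (Suc b')" using le_Suc_ex[of 2 b] by auto
  have "card {p, q} \<le> card U" using assms by (intro card_mono) auto
  then have "card U \<ge> 2" using assms by simp
  then obtain N where N: "card U = Suc (Suc N)" using le_Suc_ex[of 2 "card U"] by auto
  have count: "card {S. S \<subseteq> U \<and> card S = b \<and> p \<in> S \<and> q \<in> S} = N choose b'"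
    using card_subsets_containing[of U "{p, q}" b] assms b N by simp
  have absorb1: "real (Suc N) * real (N choose b') = real (Suc N choose Suc b') * real (Suc b')"
    using Suc_times_binomial_eq[of N b'] by (simp only: of_nat_mult[symmetric])
  have absorb2: "real (Suc (Suc N)) * real (Suc N choose Suc b') =
      real (Suc (Suc N) choose Suc (Suc b')) * real (Suc (Suc b'))"
    using Suc_times_binomial_eq[of "Suc N" "Suc b'"] by (simp only: of_nat_mult[symmetric])
  have "real (card {S. S \<subseteq> U \<and> card S = b \<and> p \<in> S \<and> q \<in> S}) * (real (Suc (Suc N)) * real (Suc N)) =
      real (Suc (Suc N)) * (real (Suc N) * real (N choose b'))"
    unfolding count by (simp only: mult_ac)
  also have "\<dots> = real (Suc (Suc N)) * real (Suc N choose Suc b') * real (Suc b')"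
    by (simp only: absorb1 mult.assoc)
  also have "\<dots> = real (Suc (Suc N) choose Suc (Suc b')) * real (Suc (Suc b')) * real (Suc b')"
    by (simp only: absorb2)
  finally have "real (card {S. S \<subseteq> U \<and> card S = b \<and> p \<in> S \<and> q \<in> S}) =
      real (Suc (Suc N) choose Suc (Suc b')) * real (Suc (Suc b')) * real (Suc b') / (real (Suc (Suc N)) * real (Suc N))"
    by (intro eq_divide_imp) (simp_all del: of_nat_Suc)
  moreover have "real b - 1 = real (Suc b')" "real (card U) - 1 = real (Suc N)"
    using b N by simp_all
  ultimately show ?thesis unfolding N b by simp
qed

text \<open>
  The mean of a hypergeometric distribution, by linearity: \<open>S \<inter> Z\<close> is counted element by element. For empty
  \<open>U\<close> both sides vanish, as division by \<open>0\<close> gives \<open>0\<close>.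
\<close>

lemma sum_card_Int:
  assumes "finite U" "Z \<subseteq> U"
  shows "(\<Sum>S | S \<subseteq> U \<and> card S = b. real (card (S \<inter> Z))) =
           real (card Z) * real b / real (card U) * real (card U choose b)"
proof -
  let ?F = "{S. S \<subseteq> U \<and> card S = b}"
  have fin: "finite ?F" "finite Z" using assms finite_subset by auto
  have "(\<Sum>S\<in>?F. real (card (S \<inter> Z))) = (\<Sum>S\<in>?F. \<Sum>p\<in>Z. of_bool (p \<in> S))"
    using fin by (intro sum.cong refl) (simp add: sum.If_cases of_bool_def Int_def conj_commute)
  also have "\<dots> = (\<Sum>p\<in>Z. \<Sum>S\<in>?F. of_bool (p \<in> S))"
    by (rule sum.swap)
  also have "\<dots> = (\<Sum>p\<in>Z. real (card {S. S \<subseteq> U \<and> card S = b \<and> p \<in> S}))"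
    using fin by (intro sum.cong refl) (simp add: sum.If_cases of_bool_def Int_def conj_assoc)
  also have "\<dots> = (\<Sum>p\<in>Z. real b / real (card U) * real (card U choose b))"
    using assms by (intro sum.cong refl card_subsets_containing_1) auto
  finally show ?thesis by simp
qed

text \<open>
  The second moment counts ordered pairs of elements of \<open>S \<inter> Z\<close>: the equal pairs give the first
  summand, the others the second. If \<open>U\<close> has at most one element, there are no others, and the second
  summand is \<open>0\<close>, as its denominator is.
\<close>

lemma sum_card_Int_squared:
  assumes "finite U" "Z \<subseteq> U"
  shows "(\<Sum>S | S \<subseteq> U \<and> card S = b. (real (card (S \<inter> Z)))\<^sup>2) =
           (real (card Z) * real b / real (card U) +
            real (card Z) * (real (card Z) - 1) * (real b * (real b - 1)) /
              (real (card U) * (real (card U) - 1))) * real (card U choose b)"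
proof -
  let ?F = "{S. S \<subseteq> U \<and> card S = b}"
  define c1 where "c1 = real b / real (card U) * real (card U choose b)"
  define c2 where "c2 = real b * (real b - 1) / (real (card U) * (real (card U) - 1)) * real (card U choose b)"
  have fin: "finite ?F" "finite Z" using assms finite_subset by auto
  have count: "(\<Sum>S\<in>?F. of_bool (p \<in> S \<and> q \<in> S)) = (if p = q then c1 else c2)"
    if "p \<in> Z" "q \<in> Z" for p q
  proof -
    have "(\<Sum>S\<in>?F. of_bool (p \<in> S \<and> q \<in> S)) = real (card {S. S \<subseteq> U \<and> card S = b \<and> p \<in> S \<and> q \<in> S})"
      using fin by (simp add: sum.If_cases of_bool_def Int_def conj_assoc)
    also have "\<dots> = (if p = q then c1 else c2)"
      using that assms card_subsets_containing_1[of U p b, folded c1_def]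
        card_subsets_containing_2[of U p q b, folded c2_def] by auto
    finally show ?thesis .
  qed
  have "(\<Sum>S\<in>?F. (real (card (S \<inter> Z)))\<^sup>2) = (\<Sum>S\<in>?F. \<Sum>p\<in>Z. \<Sum>q\<in>Z. of_bool (p \<in> S \<and> q \<in> S))"
  proof (intro sum.cong refl)
    fix S
    have "real (card (S \<inter> Z)) = (\<Sum>p\<in>Z. of_bool (p \<in> S))"
      using fin by (simp add: sum.If_cases of_bool_def Int_def conj_commute)
    then show "(real (card (S \<inter> Z)))\<^sup>2 = (\<Sum>p\<in>Z. \<Sum>q\<in>Z. of_bool (p \<in> S \<and> q \<in> S))"
      by (simp add: power2_eq_square sum_product of_bool_conj)
  qed
  also have "\<dots> = (\<Sum>p\<in>Z. \<Sum>q\<in>Z. \<Sum>S\<in>?F. of_bool (p \<in> S \<and> q \<in> S))"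
    by (subst sum.swap) (intro sum.cong refl sum.swap)
  also have "\<dots> = (\<Sum>p\<in>Z. \<Sum>q\<in>Z. if p = q then c1 else c2)"
    using count by (intro sum.cong refl)
  also have "\<dots> = (\<Sum>p\<in>Z. \<Sum>q\<in>Z. (if p = q then c1 - c2 else 0) + c2)"
    by (intro sum.cong refl) simp
  also have "\<dots> = real (card Z) * (c1 - c2) + real (card Z) * real (card Z) * c2"
    using fin by (simp add: sum.distrib distrib_left)
  also have "\<dots> = real (card Z) * c1 + real (card Z) * (real (card Z) - 1) * c2"
    by (simp add: algebra_simps)
  finally show ?thesis by (simp add: c1_def c2_def distrib_right)
qed

section \<open>Expectations over the random choices of one partitioning step\<close>

text \<open>
  This is \<open>c = (i - j) + (b - j)\<close> with \<open>j = card (S \<inter> {..<i})\<close>.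
\<close>

lemma swaps_of_positions_eq:
  assumes "S \<in> smaller_position_sets n i b"
  shows "real (swaps_of_positions i S) = real i + real b - 2 * real (card (S \<inter> {..<i}))"
proof -
  have S: "finite S" "card S = b"
    using assms by (auto simp: smaller_position_sets_def intro: finite_subset)
  have "card ({..<i} - S) + card (S \<inter> {..<i}) = i" "card (S - {..<i}) + card (S \<inter> {..<i}) = b"
    using S card_Diff_subset_Int[of S "{..<i}"] card_Diff_subset_Int[of "{..<i}" S]
      card_mono[of "{..<i}" "S \<inter> {..<i}"] card_mono[of S "S \<inter> {..<i}"]
    by (simp_all add: Int_commute)
  then show ?thesis by (simp add: swaps_of_positions_def algebra_simps)
qed

text \<open>
  The positions in front of \<open>i\<close> are the fixed set that the random subset \<open>S\<close> of the other \<open>n - 1\<close> positions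
  meets.
\<close>

lemma moments_of_swaps_of_positions:
  assumes "i < n" "b < n"
  defines "R \<equiv> smaller_position_sets n i b"
  shows "measure_pmf.expectation (pmf_of_set R) (\<lambda>S. real (swaps_of_positions i S)) =
           real i + real b - 2 * (real i * real b / (real n - 1))"
    and "measure_pmf.expectation (pmf_of_set R) (\<lambda>S. (real (swaps_of_positions i S))\<^sup>2) =
           (real i + real b)\<^sup>2 - 4 * (real i + real b) * (real i * real b / (real n - 1))
           + 4 * (real i * real b / (real n - 1)
             + real i * (real i - 1) * (real b * (real b - 1)) / ((real n - 1) * (real n - 2)))"
proof -
  define U where "U = {..<n} - {i}"
  have U: "finite U" "{..<i} \<subseteq> U" "card U = n - 1" "real (card U) = real n - 1"
    using assms by (auto simp: U_def of_nat_diff)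
  have R: "R = {S. S \<subseteq> U \<and> card S = b}"
    by (simp add: R_def smaller_position_sets_def U_def)
  have fin: "finite R" "R \<noteq> {}"
    using assms by (simp_all add: R_def finite_smaller_position_sets smaller_position_sets_nonempty)
  have C: "card R = (card U choose b)" using U by (simp add: R n_subsets)
  have C0: "real (card R) \<noteq> 0" using fin by simp
  define J where "J = real i * real b / (real n - 1)"
  define J2 where "J2 = J + real i * (real i - 1) * (real b * (real b - 1)) / ((real n - 1) * (real n - 2))"
  have s1: "(\<Sum>S\<in>R. real (card (S \<inter> {..<i}))) = J * card R"
    using sum_card_Int[OF U(1,2), of b] unfolding R[symmetric] C J_def U(4) by simp
  have s2: "(\<Sum>S\<in>R. (real (card (S \<inter> {..<i})))\<^sup>2) = J2 * card R"
    using sum_card_Int_squared[OF U(1,2), of b] unfolding R[symmetric] C[symmetric] J2_def J_def U(4)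
    by (simp add: algebra_simps)
  have "(\<Sum>S\<in>R. real (swaps_of_positions i S)) =
          (\<Sum>S\<in>R. (real i + real b) - 2 * real (card (S \<inter> {..<i})))"
    by (intro sum.cong refl) (simp add: swaps_of_positions_eq R_def)
  also have "\<dots> = (real i + real b - 2 * J) * card R"
    by (simp add: sum_subtractf s1 algebra_simps flip: sum_distrib_left)
  finally show "measure_pmf.expectation (pmf_of_set R) (\<lambda>S. real (swaps_of_positions i S)) =
           real i + real b - 2 * (real i * real b / (real n - 1))"
    using C0 fin by (simp add: integral_pmf_of_set J_def)
  have "(\<Sum>S\<in>R. (real (swaps_of_positions i S))\<^sup>2) =
          (\<Sum>S\<in>R. (real i + real b)\<^sup>2 - (4 * (real i + real b)) * real (card (S \<inter> {..<i}))
            + 4 * (real (card (S \<inter> {..<i})))\<^sup>2)"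
    by (intro sum.cong refl) (simp add: swaps_of_positions_eq R_def power2_eq_square algebra_simps)
  also have "\<dots> = ((real i + real b)\<^sup>2 - 4 * (real i + real b) * J + 4 * J2) * card R"
    unfolding sum.distrib sum_subtractf sum_distrib_left[symmetric] s1 s2
    by (simp add: algebra_simps)
  finally show "measure_pmf.expectation (pmf_of_set R) (\<lambda>S. (real (swaps_of_positions i S))\<^sup>2) =
           (real i + real b)\<^sup>2 - 4 * (real i + real b) * (real i * real b / (real n - 1))
           + 4 * (real i * real b / (real n - 1)
             + real i * (real i - 1) * (real b * (real b - 1)) / ((real n - 1) * (real n - 2)))"
    using C0 fin by (simp add: integral_pmf_of_set J_def J2_def)
qed

text \<open>
  Finite supports make all expectations finite sums, so linearity applies without integrability
  conditions, and the expectation of the product of the independent parts factors.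
\<close>

lemma expectation_add_independent:
  fixes p q :: "nat pmf" and c :: nat
  assumes "finite (set_pmf p)" "finite (set_pmf q)"
  defines "s \<equiv> bind_pmf p (\<lambda>a. bind_pmf q (\<lambda>b. return_pmf (c + a + b)))"
  shows "measure_pmf.expectation s real =
           real c + measure_pmf.expectation p real + measure_pmf.expectation q real"
    and "measure_pmf.expectation s (\<lambda>x. (real x)\<^sup>2) =
           (real c)\<^sup>2 + 2 * real c * (measure_pmf.expectation p real + measure_pmf.expectation q real)
           + measure_pmf.expectation p (\<lambda>x. (real x)\<^sup>2) + measure_pmf.expectation q (\<lambda>x. (real x)\<^sup>2)
           + 2 * measure_pmf.expectation p real * measure_pmf.expectation q real"
proof -
  have fin: "finite (set_pmf (pair_pmf p q))" using assms by simp
  note [simp] = integrable_measure_pmf_finite[OF fin]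
  have s: "s = map_pmf (\<lambda>x. c + fst x + snd x) (pair_pmf p q)"
    by (simp add: s_def pair_pmf_def map_bind_pmf map_return_pmf)
  have fst: "measure_pmf.expectation (pair_pmf p q) (\<lambda>x. real (fst x)) = measure_pmf.expectation p real"
       "measure_pmf.expectation (pair_pmf p q) (\<lambda>x. (real (fst x))\<^sup>2) = measure_pmf.expectation p (\<lambda>x. (real x)\<^sup>2)"
    by (rule expectation_pair_pmf_fst)+
  have snd: "measure_pmf.expectation (pair_pmf p q) (\<lambda>x. real (snd x)) = measure_pmf.expectation q real"
       "measure_pmf.expectation (pair_pmf p q) (\<lambda>x. (real (snd x))\<^sup>2) = measure_pmf.expectation q (\<lambda>x. (real x)\<^sup>2)"
    by (rule expectation_pair_pmf_snd)+
  have prod: "measure_pmf.expectation (pair_pmf p q) (\<lambda>x. real (fst x) * real (snd x)) =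
      measure_pmf.expectation p real * measure_pmf.expectation q real"
  proof -
    have "measure_pmf.expectation (pair_pmf p q) (\<lambda>x. real (fst x) * real (snd x)) =
        (\<Sum>x\<in>set_pmf p \<times> set_pmf q. real (fst x) * real (snd x) * pmf (pair_pmf p q) x)"
      using assms by (intro integral_measure_pmf_real) auto
    also have "\<dots> = (\<Sum>a\<in>set_pmf p. \<Sum>b\<in>set_pmf q. (real a * pmf p a) * (real b * pmf q b))"
      unfolding sum.cartesian_product by (intro sum.cong refl) (auto simp: pmf_pair)
    also have "\<dots> = (\<Sum>a\<in>set_pmf p. real a * pmf p a) * (\<Sum>b\<in>set_pmf q. real b * pmf q b)"
      by (simp add: sum_product)
    also have "(\<Sum>a\<in>set_pmf p. real a * pmf p a) = measure_pmf.expectation p real"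
      using assms by (intro integral_measure_pmf_real[symmetric]) auto
    also have "(\<Sum>a\<in>set_pmf q. real a * pmf q a) = measure_pmf.expectation q real"
      using assms by (intro integral_measure_pmf_real[symmetric]) auto
    finally show ?thesis .
  qed
  show "measure_pmf.expectation s real =
           real c + measure_pmf.expectation p real + measure_pmf.expectation q real"
    by (simp add: s fst snd)
  have "measure_pmf.expectation s (\<lambda>x. (real x)\<^sup>2) =
      measure_pmf.expectation (pair_pmf p q) (\<lambda>x. (real c)\<^sup>2 + 2 * real c * real (fst x) + 2 * real c * real (snd x)
        + (real (fst x))\<^sup>2 + (real (snd x))\<^sup>2 + 2 * (real (fst x) * real (snd x)))"
    unfolding s integral_map_pmf
    by (intro arg_cong[where f = "measure_pmf.expectation (pair_pmf p q)"] ext)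
       (simp add: power2_eq_square algebra_simps)
  also have "\<dots> = (real c)\<^sup>2 + 2 * real c * (measure_pmf.expectation p real + measure_pmf.expectation q real)
           + measure_pmf.expectation p (\<lambda>x. (real x)\<^sup>2) + measure_pmf.expectation q (\<lambda>x. (real x)\<^sup>2)
           + 2 * measure_pmf.expectation p real * measure_pmf.expectation q real"
    by (simp add: fst snd prod) (simp add: algebra_simps)
  finally show "measure_pmf.expectation s (\<lambda>x. (real x)\<^sup>2) = \<dots>" .
qed

lemma expectation_bind_pmf_of_set:
  fixes h :: "'b \<Rightarrow> real"
  assumes "finite A" "A \<noteq> {}" "\<And>x. x \<in> A \<Longrightarrow> finite (set_pmf (f x))"
  shows "measure_pmf.expectation (bind_pmf (pmf_of_set A) f) h =
           (\<Sum>x\<in>A. measure_pmf.expectation (f x) h) / real (card A)"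
  using assms by (subst pmf_expectation_bind_pmf_of_set) (simp_all add: divide_inverse sum_distrib_left mult.commute)

lemma finite_set_bind_pmf_of_set:
  assumes "finite A" "A \<noteq> {}" "\<And>x. x \<in> A \<Longrightarrow> finite (set_pmf (f x))"
  shows "finite (set_pmf (bind_pmf (pmf_of_set A) f))"
  using assms by simp

text \<open>
  The distribution of the number of swaps, conditioned on the outcome of the first partition: the pivot is
  at position \<open>i\<close>, it has \<open>b\<close> smaller elements, and these are at the positions \<open>S\<close>.
\<close>

definition swaps_given_positions :: "nat \<Rightarrow> nat \<Rightarrow> nat set \<Rightarrow> nat \<Rightarrow> nat pmf" where
  "swaps_given_positions n i S b = do {
      x \<leftarrow> swaps b;
      y \<leftarrow> swaps (n - 1 - b);
      return_pmf (swaps_of_positions i S + x + y)}"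

text \<open>
  The same recurrence indexed by the number \<open>b\<close> of smaller elements instead of the pivot \<open>b + 1\<close>; with this
  index the recursive calls have the sizes \<open>b\<close> and \<open>n - 1 - b\<close>, which add up to a convolution index.
\<close>

lemma swaps_recurrence_by_rank:
  assumes "n \<ge> 2"
  shows "swaps n = do {
      i \<leftarrow> pmf_of_set {..<n};
      b \<leftarrow> pmf_of_set {..<n};
      S \<leftarrow> pmf_of_set (smaller_position_sets n i b);
      swaps_given_positions n i S b}"
proof -
  have "bij_betw Suc {..<n} {1..n}"
    by (rule bij_betw_byWitness[where f' = "\<lambda>k. k - 1"]) auto
  then have "pmf_of_set {1..n} = map_pmf Suc (pmf_of_set {..<n})"
    using assms by (intro map_pmf_of_set_bij_betw[symmetric]) (auto simp: lessThan_empty_iff)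
  then show ?thesis
    unfolding swaps_recurrence[OF assms] swaps_given_positions_def by (simp add: bind_map_pmf)
qed

lemma finite_set_pmf_swaps: "finite (set_pmf (swaps n))"
proof (induction n rule: less_induct)
  case (less n)
  show ?case
  proof (cases "n \<ge> 2")
    case False
    then have "n = 0 \<or> n = Suc 0" by auto
    then show ?thesis by (auto simp: swaps_0 swaps_1)
  next
    case True
    have ne: "{..<n} \<noteq> {}" using True by (auto simp: lessThan_empty_iff)
    have "finite (set_pmf (swaps_given_positions n i S b))" if "b < n" for i S b
      using that by (simp add: swaps_given_positions_def less)
    then show ?thesis
      unfolding swaps_recurrence_by_rank[OF True]
      by (intro finite_set_bind_pmf_of_set finite_lessThan ne finite_smaller_position_sets
          smaller_position_sets_nonempty) simp_all
  qed
qed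

lemma expectation_swaps:
  fixes h :: "nat \<Rightarrow> real"
  assumes "n \<ge> 2"
  shows "measure_pmf.expectation (swaps n) h =
     (\<Sum>i<n. \<Sum>b<n. measure_pmf.expectation (pmf_of_set (smaller_position_sets n i b))
        (\<lambda>S. measure_pmf.expectation (swaps_given_positions n i S b) h)) / (real n)\<^sup>2"
proof -
  have ne: "{..<n} \<noteq> {}" using assms by (auto simp: lessThan_empty_iff)
  have fin: "finite (set_pmf (swaps_given_positions n i S b))" for i S b
    by (simp add: swaps_given_positions_def finite_set_pmf_swaps)
  define D where "D = (\<lambda>i b. bind_pmf (pmf_of_set (smaller_position_sets n i b)) (\<lambda>S. swaps_given_positions n i S b))"
  have fin_D: "finite (set_pmf (D i b))" if "i < n" "b < n" for i b
    unfolding D_def using that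
    by (intro finite_set_bind_pmf_of_set finite_smaller_position_sets smaller_position_sets_nonempty fin)
  have E_D: "measure_pmf.expectation (D i b) h =
      measure_pmf.expectation (pmf_of_set (smaller_position_sets n i b))
        (\<lambda>S. measure_pmf.expectation (swaps_given_positions n i S b) h)" if "i < n" "b < n" for i b
    using smaller_position_sets_nonempty[OF that] finite_smaller_position_sets[of n i b]
    by (simp add: D_def expectation_bind_pmf_of_set fin integral_pmf_of_set)
  have fin_bind: "finite (set_pmf (bind_pmf (pmf_of_set {..<n}) (D i)))" if "i < n" for i
    by (rule finite_set_bind_pmf_of_set) (use that ne fin_D in auto)
  have E_bind: "measure_pmf.expectation (bind_pmf (pmf_of_set {..<n}) (D i)) h =
      (\<Sum>b<n. measure_pmf.expectation (D i b) h) / real n" if "i < n" for i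
    using expectation_bind_pmf_of_set[of "{..<n}" "D i" h] that ne fin_D by simp
  have "swaps n = bind_pmf (pmf_of_set {..<n}) (\<lambda>i. bind_pmf (pmf_of_set {..<n}) (D i))"
    by (simp only: swaps_recurrence_by_rank[OF assms] D_def)
  then have "measure_pmf.expectation (swaps n) h =
      (\<Sum>i<n. measure_pmf.expectation (bind_pmf (pmf_of_set {..<n}) (D i)) h) / real n"
    using expectation_bind_pmf_of_set[of "{..<n}" "\<lambda>i. bind_pmf (pmf_of_set {..<n}) (D i)" h] ne fin_bind by simp
  also have "\<dots> = (\<Sum>i<n. (\<Sum>b<n. measure_pmf.expectation (D i b) h) / real n) / real n"
    by (simp add: E_bind)
  also have "\<dots> = (\<Sum>i<n. \<Sum>b<n. measure_pmf.expectation (D i b) h) / (real n)\<^sup>2"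
    by (simp add: power2_eq_square flip: sum_divide_distrib)
  finally show ?thesis by (simp add: E_D)
qed

section \<open>Convolution of the mean with itself\<close>

lemma H_0 [simp]: "H k 0 = 0"
  by (simp add: H_def)

lemma H_Suc [simp]: "H k (Suc n) = H k n + 1 / (real n + 1) ^ k"
  by (simp add: H_def add.commute)

definition convolution :: "(nat \<Rightarrow> real) \<Rightarrow> (nat \<Rightarrow> real) \<Rightarrow> nat \<Rightarrow> real" where
  "convolution f g n = (\<Sum>m\<le>n. f m * g (n - m))"

lemma convolution_commute: "convolution f g n = convolution g f n"
  unfolding convolution_def
  by (rule sum.reindex_bij_witness[of _ "\<lambda>m. n - m" "\<lambda>m. n - m"]) auto

text \<open>
  Taking a difference of a convolution is taking it in one factor. The boundary term vanishes because that
  factor starts with \<open>0\<close>.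
\<close>

lemma convolution_Suc:
  assumes "f 0 = 0" "\<And>m. f (Suc m) = f m + d m"
  shows "convolution f g (Suc n) = convolution f g n + convolution d g n"
proof -
  have "convolution f g (Suc n) = (\<Sum>m\<le>n. f (Suc m) * g (n - m))"
    unfolding convolution_def using assms(1) by (simp add: sum.atMost_Suc_shift del: sum.atMost_Suc)
  then show ?thesis
    by (simp add: convolution_def assms(2) distrib_right sum.distrib)
qed

definition mean_formula :: "nat \<Rightarrow> real" where
  "mean_formula n = (real n + 1) * H 1 n - 2 * real n"

definition mean_formula_diff :: "nat \<Rightarrow> real" where
  "mean_formula_diff n = H 1 (Suc n) - 1"

definition recip :: "nat \<Rightarrow> real" where
  "recip n = 1 / (real n + 2)"

lemma mean_formula_0: "mean_formula 0 = 0"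
  by (simp add: mean_formula_def)

lemma mean_formula_Suc: "mean_formula (Suc n) = mean_formula n + mean_formula_diff n"
  by (simp add: mean_formula_def mean_formula_diff_def field_simps)

lemma mean_formula_diff_0: "mean_formula_diff 0 = 0"
  by (simp add: mean_formula_diff_def)

lemma mean_formula_diff_Suc: "mean_formula_diff (Suc n) = mean_formula_diff n + recip n"
  by (simp add: mean_formula_diff_def recip_def add.commute)

text \<open>
  Partial fractions: the two denominators \<open>m + 2\<close> and \<open>n - m + 2\<close> have the sum \<open>n + 4\<close> for all \<open>m\<close>.
\<close>

lemma convolution_recip_recip:
  "convolution recip recip n = 2 * (H 1 (n + 2) - 1) / (real n + 4)"
proof -
  have H: "(\<Sum>m\<le>n. recip m) = H 1 (n + 2) - 1" for n
    by (induction n) (simp_all add: recip_def add.commute)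
  have "convolution recip recip n = (\<Sum>m\<le>n. (recip m + recip (n - m)) / (real n + 4))"
    unfolding convolution_def
  proof (rule sum.cong[OF refl])
    fix m assume "m \<in> {..n}"
    then have eq: "real n + 4 = (real m + 2) + (real (n - m) + 2)" by simp
    show "recip m * recip (n - m) = (recip m + recip (n - m)) / (real n + 4)"
      unfolding eq recip_def by (simp add: divide_simps)
  qed
  also have "\<dots> = ((\<Sum>m\<le>n. recip m) + (\<Sum>m\<le>n. recip (n - m))) / (real n + 4)"
    by (simp add: sum.distrib flip: sum_divide_distrib)
  also have "(\<Sum>m\<le>n. recip (n - m)) = (\<Sum>m\<le>n. recip m)"
    by (rule sum.reindex_bij_witness[of _ "\<lambda>m. n - m" "\<lambda>m. n - m"]) auto
  finally show ?thesis by (simp add: H)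
qed

text \<open>
  Here and in the next three lemmas the induction step adds the preceding convolution, by \<open>convolution_Suc\<close>.
  Each closed form is written with the harmonic numbers at the index that makes its coefficients, apart
  from one reciprocal in this first one, polynomials.
\<close>

lemma convolution_diff_recip:
  "convolution mean_formula_diff recip n =
     (H 1 (n + 2))\<^sup>2 - H 2 (n + 2) - 2 * H 1 (n + 2) + 2 * H 1 (n + 2) / (real n + 3) + 1"
proof (induction n)
  case 0
  show ?case by (simp add: convolution_def mean_formula_diff_0 power2_eq_square)
next
  case (Suc n)
  define h where "h = H 1 (n + 2)"
  have h: "H 1 (Suc n + 2) = h + 1 / (real n + 3)" by (simp add: h_def add.commute)
  have g: "H 2 (Suc n + 2) = H 2 (n + 2) + 1 / (real n + 3)\<^sup>2" by (simp add: add.commute)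
  have x: "real (Suc n) + 3 = real n + 4" by simp
  have pos: "real n + 3 \<noteq> 0" "real n + 4 \<noteq> 0" by linarith+
  have "convolution mean_formula_diff recip (Suc n) = h\<^sup>2 - H 2 (n + 2) - 2 * h + 2 * h / (real n + 3) + 1
      + 2 * (h - 1) / (real n + 4)"
    using convolution_Suc[of mean_formula_diff recip recip n] mean_formula_diff_0 mean_formula_diff_Suc Suc.IH
    by (simp add: convolution_recip_recip h_def)
  also have "\<dots> = (h + 1 / (real n + 3))\<^sup>2 - (H 2 (n + 2) + 1 / (real n + 3)\<^sup>2) - 2 * (h + 1 / (real n + 3))
      + 2 * (h + 1 / (real n + 3)) / (real n + 4) + 1"
  proof -
    have "(1 / (real n + 3)) / (real n + 4) = 1 / (real n + 3) - 1 / (real n + 4)"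
      using pos by (simp add: divide_simps)
    then show ?thesis
      by (simp add: power2_eq_square algebra_simps add_divide_distrib diff_divide_distrib)
  qed
  finally show ?case unfolding h g x .
qed

lemma convolution_diff_diff:
  "convolution mean_formula_diff mean_formula_diff n =
     (real n + 3) * ((H 1 (n + 2))\<^sup>2 - H 2 (n + 2)) - 4 * (real n + 2) * H 1 (n + 2) - 1 + 5 * (real n + 2)"
proof (induction n)
  case 0
  show ?case by (simp add: convolution_def mean_formula_diff_0 power2_eq_square)
next
  case (Suc n)
  define h g x where "h = H 1 (n + 2)" "g = H 2 (n + 2)" "x = real n + 3"
  have h: "H 1 (Suc n + 2) = h + 1 / x" by (simp add: h_g_x_def add.commute)
  have g: "H 2 (Suc n + 2) = g + 1 / x\<^sup>2" by (simp add: h_g_x_def add.commute)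
  have x: "real (Suc n) + 3 = x + 1" "real (Suc n) + 2 = x" "real n + 2 = x - 1" "real n + 3 = x"
    by (simp_all add: h_g_x_def)
  have pos: "x \<noteq> 0" unfolding h_g_x_def by linarith
  have "convolution mean_formula_diff mean_formula_diff (Suc n) =
      x * (h\<^sup>2 - g) - 4 * (x - 1) * h - 1 + 5 * (x - 1) + (h\<^sup>2 - g - 2 * h + 2 * h / x + 1)"
    using convolution_Suc[of mean_formula_diff recip mean_formula_diff n]
      convolution_commute[of recip mean_formula_diff n]
      mean_formula_diff_0 mean_formula_diff_Suc Suc.IH
    by (simp only: convolution_diff_recip x h_g_x_def(1,2))
  also have "\<dots> = (x + 1) * ((h + 1 / x)\<^sup>2 - (g + 1 / x\<^sup>2)) - 4 * x * (h + 1 / x) - 1 + 5 * x"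
    using pos by (simp add: field_simps power2_eq_square)
  finally show ?case unfolding h g x .
qed

lemma convolution_diff_mean:
  "convolution mean_formula_diff mean_formula n =
     (1 + 3 / 2 * (real n + 1) + (real n + 1)\<^sup>2 / 2) * ((H 1 (n + 1))\<^sup>2 - H 2 (n + 1))
     - (7 / 2 * (real n + 1) + 5 / 2 * (real n + 1)\<^sup>2) * H 1 (n + 1)
     + 9 / 4 * (real n + 1) + 15 / 4 * (real n + 1)\<^sup>2"
proof (induction n)
  case 0
  show ?case by (simp add: convolution_def mean_formula_diff_0 power2_eq_square)
next
  case (Suc n)
  define h g x where "h = H 1 (n + 1)" "g = H 2 (n + 1)" "x = real n + 2"
  have h: "H 1 (Suc n + 1) = h + 1 / x" "H 1 (n + 2) = h + 1 / x" by (simp_all add: h_g_x_def add.commute)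
  have g: "H 2 (Suc n + 1) = g + 1 / x\<^sup>2" "H 2 (n + 2) = g + 1 / x\<^sup>2" by (simp_all add: h_g_x_def add.commute)
  have x: "real (Suc n) + 1 = x" "real n + 1 = x - 1" "real n + 2 = x" "real n + 3 = x + 1"
    by (simp_all add: h_g_x_def)
  have pos: "x \<noteq> 0" unfolding h_g_x_def by linarith
  have "convolution mean_formula_diff mean_formula (Suc n) =
      (1 + 3 / 2 * (x - 1) + (x - 1)\<^sup>2 / 2) * (h\<^sup>2 - g)
       - (7 / 2 * (x - 1) + 5 / 2 * (x - 1)\<^sup>2) * h
       + 9 / 4 * (x - 1) + 15 / 4 * (x - 1)\<^sup>2
      + ((x + 1) * ((h + 1 / x)\<^sup>2 - (g + 1 / x\<^sup>2)) - 4 * x * (h + 1 / x) - 1 + 5 * x)"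
    using convolution_Suc[of mean_formula mean_formula_diff mean_formula_diff n]
      convolution_commute[of mean_formula mean_formula_diff]
      mean_formula_0 mean_formula_Suc Suc.IH
    by (simp only: convolution_diff_diff x h g h_g_x_def(1,2)[symmetric])
  also have "\<dots> = (1 + 3 / 2 * x + x\<^sup>2 / 2) * ((h + 1 / x)\<^sup>2 - (g + 1 / x\<^sup>2))
       - (7 / 2 * x + 5 / 2 * x\<^sup>2) * (h + 1 / x) + 9 / 4 * x + 15 / 4 * x\<^sup>2"
    using pos by (simp add: field_simps power2_eq_square)
  finally show ?case unfolding h g x .
qed

lemma convolution_mean_mean:
  "convolution mean_formula mean_formula n =
     (let x = real n + 1 in
     (x / 3 + x\<^sup>2 / 2 + x ^ 3 / 6) * ((H 1 (n + 1))\<^sup>2 - H 2 (n + 1))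
     + (x / 9 - 7 / 6 * x\<^sup>2 - 17 / 18 * x ^ 3) * H 1 (n + 1)
     + 7 / 54 * x + 11 / 36 * x\<^sup>2 + 169 / 108 * x ^ 3)"
proof (induction n)
  case 0
  show ?case by (simp add: convolution_def mean_formula_0 power2_eq_square)
next
  case (Suc n)
  define h g x where "h = H 1 (n + 1)" "g = H 2 (n + 1)" "x = real n + 2"
  have h: "H 1 (Suc n + 1) = h + 1 / x" by (simp_all add: h_g_x_def add.commute)
  have g: "H 2 (Suc n + 1) = g + 1 / x\<^sup>2" by (simp_all add: h_g_x_def add.commute)
  have x: "real (Suc n) + 1 = x" "real n + 1 = x - 1"
    by (simp_all add: h_g_x_def)
  have pos: "x \<noteq> 0" unfolding h_g_x_def by linarith
  let ?y = "x - 1"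
  have "convolution mean_formula mean_formula (Suc n) =
     (?y / 3 + ?y\<^sup>2 / 2 + ?y ^ 3 / 6) * (h\<^sup>2 - g)
     + (?y / 9 - 7 / 6 * ?y\<^sup>2 - 17 / 18 * ?y ^ 3) * h
     + 7 / 54 * ?y + 11 / 36 * ?y\<^sup>2 + 169 / 108 * ?y ^ 3
     + ((1 + 3 / 2 * ?y + ?y\<^sup>2 / 2) * (h\<^sup>2 - g) - (7 / 2 * ?y + 5 / 2 * ?y\<^sup>2) * h
     + 9 / 4 * ?y + 15 / 4 * ?y\<^sup>2)"
    using convolution_Suc[of mean_formula mean_formula_diff mean_formula n]
      mean_formula_0 mean_formula_Suc Suc.IH
    by (simp only: convolution_diff_mean x Let_def h_g_x_def(1,2)[symmetric])
  also have "\<dots> = (x / 3 + x\<^sup>2 / 2 + x ^ 3 / 6) * ((h + 1 / x)\<^sup>2 - (g + 1 / x\<^sup>2))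
     + (x / 9 - 7 / 6 * x\<^sup>2 - 17 / 18 * x ^ 3) * (h + 1 / x)
     + 7 / 54 * x + 11 / 36 * x\<^sup>2 + 169 / 108 * x ^ 3"
    using pos by (simp add: field_simps power2_eq_square power3_eq_cube)
  finally show ?case unfolding h g x Let_def .
qed

text \<open>
  The variance of the theorem plus the square of the mean.
\<close>

definition second_moment_formula :: "nat \<Rightarrow> real" where
  "second_moment_formula n = 1 / 6 * real n * (11 * real n + 17) - 1 / 3 * (real n + 1) * H 1 n
     - (real n + 1)\<^sup>2 * H 2 n + (mean_formula n)\<^sup>2"

text \<open>
  This and the next lemma say that the closed forms satisfy the recurrences of the first and the second
  moment.
\<close>

lemma sum_mean_formula:
  "2 * (\<Sum>m<n. mean_formula m) = real n * mean_formula n - real n * (real n - 1) / 2"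
proof (induction n)
  case (Suc n)
  have "2 * (\<Sum>m<Suc n. mean_formula m) =
      real n * mean_formula n - real n * (real n - 1) / 2 + 2 * mean_formula n"
    using Suc.IH by simp
  also have "\<dots> = real (Suc n) * mean_formula (Suc n) - real (Suc n) * (real (Suc n) - 1) / 2"
    by (simp add: mean_formula_Suc) (simp add: mean_formula_def mean_formula_diff_def field_simps)
  finally show ?case .
qed simp

text \<open>
  Consecutive instances of the recurrence are subtracted in the induction step, so that only the difference
  of the convolutions, \<open>convolution_diff_mean\<close>, is needed, and a rational identity in \<open>n\<close> and the harmonic
  numbers remains.
\<close>

lemma sum_second_moment_formula:
  "2 * (\<Sum>m<Suc n. second_moment_formula m) =
     (real n + 1) * second_moment_formula (Suc n) - (real n + 1) * (5 * (real n)\<^sup>2 + 4 * real n) / 18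
     - 2 * real n * (\<Sum>m<Suc n. mean_formula m) - 2 * convolution mean_formula mean_formula n"
proof (induction n)
  case 0
  show ?case by (simp add: second_moment_formula_def mean_formula_def convolution_def)
next
  case (Suc n)
  define h g x where "h = H 1 (n + 1)" "g = H 2 (n + 1)" "x = real n + 2"
  have h: "H 1 (Suc n) = h" "H 1 (Suc (Suc n)) = h + 1 / x" by (simp_all add: h_g_x_def add.commute)
  have g: "H 2 (Suc n) = g" "H 2 (Suc (Suc n)) = g + 1 / x\<^sup>2" by (simp_all add: h_g_x_def add.commute)
  have x: "real (Suc n) = x - 1" "real n = x - 2" "real (Suc (Suc n)) = x"
    by (simp_all add: h_g_x_def)
  have pos: "x \<noteq> 0" unfolding h_g_x_def by linarith
  let ?y = "x - 1"
  have m: "mean_formula (Suc n) = x * h - 2 * ?y" "mean_formula (Suc (Suc n)) = (x + 1) * (h + 1 / x) - 2 * x"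
    unfolding mean_formula_def h x by simp_all
  have s: "second_moment_formula (Suc n) = 1 / 6 * ?y * (11 * ?y + 17) - 1 / 3 * x * h - x\<^sup>2 * g + (x * h - 2 * ?y)\<^sup>2"
    "second_moment_formula (Suc (Suc n)) = 1 / 6 * x * (11 * x + 17) - 1 / 3 * (x + 1) * (h + 1 / x)
        - (x + 1)\<^sup>2 * (g + 1 / x\<^sup>2) + ((x + 1) * (h + 1 / x) - 2 * x)\<^sup>2"
    unfolding second_moment_formula_def m h g x by simp_all
  have c: "convolution mean_formula mean_formula (Suc n) = convolution mean_formula mean_formula n
     + ((1 + 3 / 2 * ?y + ?y\<^sup>2 / 2) * (h\<^sup>2 - g) - (7 / 2 * ?y + 5 / 2 * ?y\<^sup>2) * h
     + 9 / 4 * ?y + 15 / 4 * ?y\<^sup>2)"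
    using convolution_Suc[of mean_formula mean_formula_diff mean_formula n] mean_formula_0 mean_formula_Suc
    by (simp only: convolution_diff_mean x h_g_x_def(1,2)[symmetric]) simp
  define M where "M = (\<Sum>m<Suc n. mean_formula m)"
  have M: "(\<Sum>m<Suc (Suc n). mean_formula m) = M + (x * h - 2 * ?y)"
    by (simp add: M_def m)
  have M': "M = (?y * (x * h - 2 * ?y) - ?y * (?y - 1) / 2) / 2"
    using sum_mean_formula[of "Suc n"] unfolding M_def[symmetric] m x by simp
  have "2 * (\<Sum>m<Suc (Suc n). second_moment_formula m) =
      2 * (\<Sum>m<Suc n. second_moment_formula m) + 2 * second_moment_formula (Suc n)"
    by (simp only: sum.lessThan_Suc[of _ "Suc n"] distrib_left)
  note step = this[unfolded Suc.IH, folded M_def]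
  show ?case
    unfolding step M c s x M' using pos
    by (simp add: field_simps power2_eq_square power3_eq_cube)
qed

section \<open>Recurrences for the first two moments and their solution\<close>

lemma sum_real_lessThan: "(\<Sum>i<n. real i) = real n * (real n - 1) / 2"
  by (induction n) (simp_all add: field_simps)

lemma sum_real_squared_lessThan: "(\<Sum>i<n. (real i)\<^sup>2) = real n * (real n - 1) * (2 * real n - 1) / 6"
  by (induction n) (simp_all add: field_simps power2_eq_square)

lemma sum_falling_factorial_2_lessThan:
  "(\<Sum>i<n. real i * (real i - 1)) = real n * (real n - 1) * (real n - 2) / 3"
  by (induction n) (simp_all add: field_simps)

text \<open>
  The key cancellation: the average position is \<open>(n - 1) / 2\<close>, so the average of \<open>2 * i * b / (n - 1)\<close> is exactly
  \<open>b\<close>, and the number of smaller elements has no influence on the mean cost of the step.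
\<close>

lemma sum_partition_mean:
  assumes "n \<ge> 2"
  shows "(\<Sum>i<n. real i + real b - 2 * (real i * real b / (real n - 1))) = real n * (real n - 1) / 2"
proof -
  have "(\<Sum>i<n. real i + real b - 2 * (real i * real b / (real n - 1))) =
      (\<Sum>i<n. real i + real b - 2 * real b / (real n - 1) * real i)"
    by (simp add: mult.commute mult.left_commute)
  also have "\<dots> = real n * (real n - 1) / 2 + real n * real b - 2 * real b / (real n - 1) * (real n * (real n - 1) / 2)"
    unfolding sum_subtractf sum.distrib sum_distrib_left[symmetric] sum_real_lessThan by simp
  also have "\<dots> = real n * (real n - 1) / 2"
    using assms by simp
  finally show ?thesis .
qed

text \<open>
  The summand is a linear combination of products of a function of \<open>i\<close> and a function of \<open>b\<close>, so the double
  sum factors into power sums. For \<open>n = 2\<close> the term with the denominator \<open>N * (n - 2) = 0\<close> is \<open>0\<close>, and so is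
  the sum of its numerators.
\<close>

lemma sum_partition_second_moment:
  assumes "n \<ge> 2"
  defines "N \<equiv> real n - 1"
  shows "(\<Sum>i<n. \<Sum>b<n. (real i + real b)\<^sup>2 - 4 * (real i + real b) * (real i * real b / N)
           + 4 * (real i * real b / N + real i * (real i - 1) * (real b * (real b - 1)) / (N * (real n - 2))))
         = (real n)\<^sup>2 * (5 * N\<^sup>2 + 4 * N) / 18"
proof -
  define s1 s2 f2 where "s1 = (\<Sum>i<n. real i)" "s2 = (\<Sum>i<n. (real i)\<^sup>2)"
    "f2 = (\<Sum>i<n. real i * (real i - 1))"
  have product: "(\<Sum>i<n. \<Sum>b<n. c * (x i * y b)) = c * ((\<Sum>i<n. x i) * (\<Sum>b<n. y b))"
    for c :: real and x y :: "nat \<Rightarrow> real"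
    unfolding sum_product by (simp only: sum_distrib_left)
  have N0: "N \<noteq> 0" using assms by simp
  let ?e = "\<lambda>i b. (real i + real b)\<^sup>2 - 4 * (real i + real b) * (real i * real b / N)
           + 4 * (real i * real b / N + real i * (real i - 1) * (real b * (real b - 1)) / (N * (real n - 2)))"
  have "(\<Sum>i<n. \<Sum>b<n. ?e i b) = (\<Sum>i<n. \<Sum>b<n. 1 * ((real i)\<^sup>2 * 1) + 1 * (1 * (real b)\<^sup>2)
      + (2 + 4 / N) * (real i * real b) + (- 4 / N) * ((real i)\<^sup>2 * real b) + (- 4 / N) * (real i * (real b)\<^sup>2)
      + 4 / (N * (real n - 2)) * ((real i * (real i - 1)) * (real b * (real b - 1))))"
  proof (intro sum.cong refl)
    fix i b
    show "?e i b = 1 * ((real i)\<^sup>2 * 1) + 1 * (1 * (real b)\<^sup>2)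
      + (2 + 4 / N) * (real i * real b) + (- 4 / N) * ((real i)\<^sup>2 * real b) + (- 4 / N) * (real i * (real b)\<^sup>2)
      + 4 / (N * (real n - 2)) * ((real i * (real i - 1)) * (real b * (real b - 1)))"
      unfolding divide_inverse[of _ "N * (real n - 2)"] divide_inverse[of _ N]
      by (simp add: power2_eq_square algebra_simps)
  qed
  also have "\<dots> = 2 * real n * s2 + (2 + 4 / N) * s1\<^sup>2 - 8 / N * (s1 * s2) + 4 / (N * (real n - 2)) * f2\<^sup>2"
    unfolding sum.distrib product s1_s2_f2_def[symmetric]
    by (simp add: power2_eq_square algebra_simps)
  also have "4 / (N * (real n - 2)) * f2\<^sup>2 = 4 / 9 * (real n)\<^sup>2 * N * (real n - 2)"
  proof (cases "real n - 2 = 0")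
    case False
    have f2: "f2 = real n * (N * (real n - 2)) / 3"
      by (simp add: s1_s2_f2_def sum_falling_factorial_2_lessThan N_def)
    show ?thesis unfolding f2 using False N0 by (simp add: power2_eq_square)
  qed simp
  also have "2 * real n * s2 + (2 + 4 / N) * s1\<^sup>2 - 8 / N * (s1 * s2) + 4 / 9 * (real n)\<^sup>2 * N * (real n - 2) =
      (real n)\<^sup>2 * (5 * N\<^sup>2 + 4 * N) / 18"
  proof -
    have n: "real n = N + 1" by (simp add: N_def)
    have s: "s1 = (N + 1) * N / 2" "s2 = (N + 1) * N * (2 * N + 1) / 6"
      unfolding s1_s2_f2_def sum_real_lessThan sum_real_squared_lessThan n by simp_all
    show ?thesis unfolding n s using N0 by (simp add: field_simps power2_eq_square)
  qed
  finally show ?thesis .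
qed

lemma sum_reverse: "(\<Sum>b<n. f (n - 1 - b)) = (\<Sum>b<n. f b :: real)" for n :: nat
  using sum.nat_diff_reindex[of f n] by simp

definition swaps_mean :: "nat \<Rightarrow> real" where
  "swaps_mean n = measure_pmf.expectation (swaps n) real"

definition swaps_second_moment :: "nat \<Rightarrow> real" where
  "swaps_second_moment n = measure_pmf.expectation (swaps n) (\<lambda>x. (real x)\<^sup>2)"

lemma expectation_given_positions:
  assumes "i < n" "b < n"
  defines "R \<equiv> pmf_of_set (smaller_position_sets n i b)"
  shows "measure_pmf.expectation R (\<lambda>S. measure_pmf.expectation (swaps_given_positions n i S b) real) =
           measure_pmf.expectation R (\<lambda>S. real (swaps_of_positions i S))
           + swaps_mean b + swaps_mean (n - 1 - b)"
    and "measure_pmf.expectation R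
             (\<lambda>S. measure_pmf.expectation (swaps_given_positions n i S b) (\<lambda>x. (real x)\<^sup>2)) =
           measure_pmf.expectation R (\<lambda>S. (real (swaps_of_positions i S))\<^sup>2)
           + 2 * measure_pmf.expectation R (\<lambda>S. real (swaps_of_positions i S))
               * (swaps_mean b + swaps_mean (n - 1 - b))
           + swaps_second_moment b + swaps_second_moment (n - 1 - b)
           + 2 * swaps_mean b * swaps_mean (n - 1 - b)"
proof -
  have "finite (set_pmf R)"
    using assms by (simp add: R_def finite_smaller_position_sets smaller_position_sets_nonempty)
  note [simp] = integrable_measure_pmf_finite[OF this]
  note independent = expectation_add_independent[OF finite_set_pmf_swaps finite_set_pmf_swaps]
  have mean: "measure_pmf.expectation (swaps_given_positions n i S b) real =
      real (swaps_of_positions i S) + swaps_mean b + swaps_mean (n - 1 - b)" for S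
    unfolding swaps_given_positions_def swaps_mean_def by (rule independent(1))
  have second: "measure_pmf.expectation (swaps_given_positions n i S b) (\<lambda>x. (real x)\<^sup>2) =
      (real (swaps_of_positions i S))\<^sup>2
      + 2 * real (swaps_of_positions i S) * (swaps_mean b + swaps_mean (n - 1 - b))
      + swaps_second_moment b + swaps_second_moment (n - 1 - b)
      + 2 * swaps_mean b * swaps_mean (n - 1 - b)" for S
    unfolding swaps_given_positions_def swaps_mean_def swaps_second_moment_def by (rule independent(2))
  show "measure_pmf.expectation R (\<lambda>S. measure_pmf.expectation (swaps_given_positions n i S b) real) =
           measure_pmf.expectation R (\<lambda>S. real (swaps_of_positions i S))
           + swaps_mean b + swaps_mean (n - 1 - b)"
    unfolding mean by simp
  show "measure_pmf.expectation R
             (\<lambda>S. measure_pmf.expectation (swaps_given_positions n i S b) (\<lambda>x. (real x)\<^sup>2)) =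
           measure_pmf.expectation R (\<lambda>S. (real (swaps_of_positions i S))\<^sup>2)
           + 2 * measure_pmf.expectation R (\<lambda>S. real (swaps_of_positions i S))
               * (swaps_mean b + swaps_mean (n - 1 - b))
           + swaps_second_moment b + swaps_second_moment (n - 1 - b)
           + 2 * swaps_mean b * swaps_mean (n - 1 - b)"
    unfolding second by simp
qed

lemma swaps_mean_recurrence:
  assumes "n \<ge> 2"
  shows "real n * swaps_mean n = real n * (real n - 1) / 2 + 2 * (\<Sum>m<n. swaps_mean m)"
proof -
  let ?e = "\<lambda>i b. real i + real b - 2 * (real i * real b / (real n - 1))"
  have "(real n)\<^sup>2 * swaps_mean n = (\<Sum>i<n. \<Sum>b<n. ?e i b + swaps_mean b + swaps_mean (n - 1 - b))"
    unfolding swaps_mean_def[of n] expectation_swaps[OF assms] using assms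
    by (simp add: expectation_given_positions(1) moments_of_swaps_of_positions(1))
  also have "\<dots> = (\<Sum>i<n. \<Sum>b<n. ?e i b) + real n * (2 * (\<Sum>m<n. swaps_mean m))"
    by (simp only: sum.distrib sum_reverse) (simp add: algebra_simps)
  also have "(\<Sum>i<n. \<Sum>b<n. ?e i b) = real n * (real n * (real n - 1) / 2)"
    by (subst sum.swap) (simp only: sum_partition_mean[OF assms], simp)
  finally have "real n * (real n * swaps_mean n) = real n * (real n * (real n - 1) / 2 + 2 * (\<Sum>m<n. swaps_mean m))"
    by (simp add: power2_eq_square algebra_simps)
  then show ?thesis using assms by (subst (asm) mult_left_cancel) auto
qed

text \<open>
  Expanding the square of \<open>c + X\<^sub>b + X'\<^sub>N\<^sub>-\<^sub>b\<close>, the mixed terms with \<open>c\<close> only need the mean of \<open>c\<close> given \<open>b\<close>, which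
  is \<open>N / 2\<close> for all \<open>b\<close>, and the mixed terms of the recursive calls form the convolution.
\<close>

lemma swaps_second_moment_recurrence:
  assumes "n \<ge> 2"
  shows "real n * swaps_second_moment n =
      real n * (5 * (real n - 1)\<^sup>2 + 4 * (real n - 1)) / 18
      + 2 * (real n - 1) * (\<Sum>m<n. swaps_mean m) + 2 * (\<Sum>m<n. swaps_second_moment m)
      + 2 * convolution swaps_mean swaps_mean (n - 1)"
proof -
  define N where "N = real n - 1"
  define e1 where "e1 = (\<lambda>i b. real i + real b - 2 * (real i * real b / N))"
  define e2 where "e2 = (\<lambda>i b. (real i + real b)\<^sup>2 - 4 * (real i + real b) * (real i * real b / N)
           + 4 * (real i * real b / N + real i * (real i - 1) * (real b * (real b - 1)) / (N * (real n - 2))))"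
  define M where "M = (\<lambda>b. swaps_mean b + swaps_mean (n - 1 - b))"
  have M: "(\<Sum>b<n. M b) = 2 * (\<Sum>m<n. swaps_mean m)"
    unfolding M_def by (simp only: sum.distrib sum_reverse mult_2)
  have "(real n)\<^sup>2 * swaps_second_moment n =
      (\<Sum>i<n. \<Sum>b<n. e2 i b + 2 * e1 i b * M b + swaps_second_moment b + swaps_second_moment (n - 1 - b)
         + 2 * swaps_mean b * swaps_mean (n - 1 - b))"
    unfolding swaps_second_moment_def[of n] expectation_swaps[OF assms] e1_def e2_def M_def N_def using assms
    by (simp add: expectation_given_positions(2) moments_of_swaps_of_positions)
  also have "\<dots> = (\<Sum>i<n. \<Sum>b<n. e2 i b) + 2 * (\<Sum>i<n. \<Sum>b<n. e1 i b * M b)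
      + real n * (2 * (\<Sum>m<n. swaps_second_moment m))
      + real n * (2 * (\<Sum>b<n. swaps_mean b * swaps_mean (n - 1 - b)))"
    by (simp only: sum.distrib sum_reverse mult.assoc sum_distrib_left[symmetric])
      (simp add: algebra_simps)
  also have "(\<Sum>b<n. swaps_mean b * swaps_mean (n - 1 - b)) = convolution swaps_mean swaps_mean (n - 1)"
    unfolding convolution_def using assms by (intro sum.cong) auto
  also have "(\<Sum>i<n. \<Sum>b<n. e2 i b) = (real n)\<^sup>2 * (5 * N\<^sup>2 + 4 * N) / 18"
    unfolding e2_def N_def by (rule sum_partition_second_moment[OF assms])
  also have "(\<Sum>i<n. \<Sum>b<n. e1 i b * M b) = (\<Sum>b<n. (\<Sum>i<n. e1 i b) * M b)"
    by (subst sum.swap) (simp add: sum_distrib_right)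
  also have "\<dots> = real n * N * (\<Sum>m<n. swaps_mean m)"
    unfolding e1_def N_def sum_partition_mean[OF assms] sum_distrib_left[symmetric] M by simp
  finally have "real n * (real n * swaps_second_moment n) =
      real n * (real n * (5 * N\<^sup>2 + 4 * N) / 18
      + 2 * N * (\<Sum>m<n. swaps_mean m) + 2 * (\<Sum>m<n. swaps_second_moment m)
      + 2 * convolution swaps_mean swaps_mean (n - 1))"
    by (simp add: power2_eq_square algebra_simps)
  then show ?thesis unfolding N_def using assms by (subst (asm) mult_left_cancel) auto
qed

lemma swaps_mean_eq: "swaps_mean n = mean_formula n"
proof (induction n rule: less_induct)
  case (less n)
  show ?case
  proof (cases "n \<ge> 2")
    case False
    then have "n = 0 \<or> n = Suc 0" by auto
    then show ?thesis by (auto simp: swaps_mean_def swaps_0 swaps_1 mean_formula_def)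
  next
    case True
    have "(\<Sum>m<n. swaps_mean m) = (\<Sum>m<n. mean_formula m)"
      using less by (intro sum.cong) auto
    then have "real n * swaps_mean n = real n * mean_formula n"
      using swaps_mean_recurrence[OF True] sum_mean_formula[of n] by linarith
    then show ?thesis using True by simp
  qed
qed

lemma swaps_second_moment_eq: "swaps_second_moment n = second_moment_formula n"
proof (induction n rule: less_induct)
  case (less n)
  show ?case
  proof (cases "n \<ge> 2")
    case False
    then have "n = 0 \<or> n = Suc 0" by auto
    then show ?thesis
      by (auto simp: swaps_second_moment_def swaps_0 swaps_1 second_moment_formula_def mean_formula_def)
  next
    case True
    then obtain k where n: "n = Suc k" by (cases n) auto
    have mean: "swaps_mean = mean_formula" using swaps_mean_eq by blast
    have second: "(\<Sum>m<n. swaps_second_moment m) = (\<Sum>m<n. second_moment_formula m)"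
      using less by (intro sum.cong) auto
    have n': "real n - 1 = real k" "n - 1 = k" "real k + 1 = real n" by (simp_all add: n)
    have "real n * swaps_second_moment n = real n * second_moment_formula n"
      using swaps_second_moment_recurrence[OF True] sum_second_moment_formula[of k]
      unfolding mean second n' n[symmetric] by linarith
    then show ?thesis using True by simp
  qed
qed

theorem theorem4p10:
  fixes n :: nat
  assumes "n \<ge> 1"
  shows "measure_pmf.variance (swaps n) real =
           1 / 6 * real n * (11 * real n + 17)
           - 1 / 3 * (real n + 1) * H 1 n
           - (real n + 1)\<^sup>2 * H 2 n"
proof -
  have "measure_pmf.variance (swaps n) real = swaps_second_moment n - (swaps_mean n)\<^sup>2"
    unfolding swaps_second_moment_def swaps_mean_def
    by (intro measure_pmf.variance_eq integrable_measure_pmf_finite finite_set_pmf_swaps)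
  also have "\<dots> = second_moment_formula n - (mean_formula n)\<^sup>2"
    by (simp only: swaps_mean_eq swaps_second_moment_eq)
  also have "\<dots> = 1 / 6 * real n * (11 * real n + 17) - 1 / 3 * (real n + 1) * H 1 n
       - (real n + 1)\<^sup>2 * H 2 n"
    unfolding second_moment_formula_def by (rule add_diff_cancel_right')
  finally show ?thesis .
qed

end
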